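(* Let $D\ge2$ be an integer, let $S_D=S_D(L_1,\dots,L_D)$ be a star graph, and let $f:S_D\to\mathbb{R}$ be a bounded measurable function, not a.e. zero, with $\int_{S_D}f\,dx=0$, finite nonempty effective nodal set $Z(f)$, and such that all edges are sufficiently long: $L_j>\|f\|_1/\|f\|_\infty$ for all $1\le j\le D$. Then $$W_1(f_+,f_-)\,\tilde N\ \ge\ \frac14\,\frac{\|f\|_1}{\|f\|_\infty}\,\|f\|_1,\qquad \tilde N=|Z(f)|-1+\begin{cases}\dfrac D2, & D\text{ even},\\[2mm] \dfrac{(D+1)(D-1)}{2D}, & D\text{ odd}.\end{cases}$$
   Context: Star graph. Given $D\in\mathbb{N}_+$ and $L_1,\dots,L_D>0$, $S_D(L_1,\dots,L_D)$ is the quotient of the disjoint union of the intervals $I_j=[0,L_j)$, $1\le j\le D$, obtained by identifying all the points $0_{I_j}$ to a single point $0$ (the vertex). The $I_j$ are the edges, $L_j$ their lengths. The distance between $x\in I_j$ and $y\in I_k$ is $|x-y|$ if $j=k$ and $x+y$ otherwise. Effective nodal set (on $I=S_D$). For a measurable $f:I\to\mathbb{R}$ with finite $L^1$ and $L^\infty$ norms, let $Z_1(f)=\partial\{f>0\}\cap\partial\{f<0\}$. Let $\mathcal{Z}(f)$ be the set of connected components of $f^{-1}(\{0\})$, and $\mathcal{Z}'(f)\subseteq\mathcal{Z}(f)$ those whose closure intersects both $\partial\{f>0\}$ and $\partial\{f<0\}$. Let $Z_2(f)$ consist of a unique point $x\in J$ for every $J\in\mathcal{Z}'(f)$. Then $Z(f)=Z_1(f)\cup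 Z_2(f)$. Transport. $f_\pm=\pm\max(\pm f,0)$, and $W_1(f_+,f_-)$ is the Wasserstein-1 distance, with respect to the geodesic distance on $S_D$, between the two finite measures of equal mass with densities $f_+$ and $|f_-|$: the infimum over all couplings $\gamma$ of these measures of $\int \mathrm{dist}(x,y)\,d\gamma(x,y)$ (no normalization to mass one). *)

theory Defs
  imports "HOL-Probability.Probability"
begin

section \<open>Star graphs\<close>

text \<open>
  A point of the star graph with \<open>D\<close> edges of lengths \<open>L 1, \<dots>, L D\<close> is represented by a pair of an
  edge index and a coordinate. The identification of the points \<open>(j, 0)\<close> is realised by the canonical
  representative \<open>(0, 0)\<close> for the vertex; \<open>star_point j x\<close> is the class of \<open>x\<close> in the \<open>j\<close>-th edge.
\<close>

definition star_point :: "nat \<Rightarrow> real \<Rightarrow> nat \<times> real"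
  where "star_point j x = (if x = 0 then (0, 0) else (j, x))"

definition star_edges :: "nat \<Rightarrow> (nat \<Rightarrow> real) \<Rightarrow> (nat \<times> real) set"
  where "star_edges D L = (SIGMA j:{1..D}. {0..<L j})"

definition star :: "nat \<Rightarrow> (nat \<Rightarrow> real) \<Rightarrow> (nat \<times> real) set"
  where "star D L = (\<lambda>(j, x). star_point j x) ` star_edges D L"

text \<open>
  Coordinates are nonnegative on \<open>star D L\<close>; the absolute values only make the distance total and
  nonnegative on the whole type, as \<open>Metric_space\<close> demands.
\<close>

definition star_dist :: "nat \<times> real \<Rightarrow> nat \<times> real \<Rightarrow> real"
  where "star_dist p q =
    (if fst p = fst q then \<bar>snd p - snd q\<bar> else \<bar>snd p\<bar> + \<bar>snd q\<bar>)"

definition star_topology :: "nat \<Rightarrow> (nat \<Rightarrow> real) \<Rightarrow> (nat \<times> real) topology"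
  where "star_topology D L = Metric_space.mtopology (star D L) star_dist"

lemma Metric_space_star: "Metric_space (star D L) star_dist"
proof
  fix p q show "0 \<le> star_dist p q" "star_dist p q = star_dist q p"
    by (auto simp: star_dist_def)
next
  fix p q assume "p \<in> star D L" "q \<in> star D L"
  then show "star_dist p q = 0 \<longleftrightarrow> p = q"
    by (auto simp: star_dist_def star_def star_edges_def star_point_def split: if_splits)
next
  fix p q r show "star_dist p r \<le> star_dist p q + star_dist q r"
    by (auto simp: star_dist_def)
qed

lemma star_dist_star_point:
  assumes "0 \<le> x" "0 \<le> y"
  shows "star_dist (star_point j x) (star_point k y) = (if j = k then \<bar>x - y\<bar> else x + y)"
  using assms by (auto simp: star_dist_def star_point_def)

lemma topspace_star [simp]: "topspace (star_topology D L) = star D L"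
  by (simp add: star_topology_def Metric_space.topspace_mtopology[OF Metric_space_star])


section \<open>Length measure\<close>

definition star_borel :: "nat \<Rightarrow> (nat \<Rightarrow> real) \<Rightarrow> (nat \<times> real) measure"
  where "star_borel D L = sigma (star D L) {U. openin (star_topology D L) U}"

definition star_measure :: "nat \<Rightarrow> (nat \<Rightarrow> real) \<Rightarrow> (nat \<times> real) measure"
  where "star_measure D L =
    distr (restrict_space (count_space UNIV \<Otimes>\<^sub>M lborel) (star_edges D L)) (star_borel D L)
      (\<lambda>(j, x). star_point j x)"

definition star_lebesgue :: "nat \<Rightarrow> (nat \<Rightarrow> real) \<Rightarrow> (nat \<times> real) measure"
  where "star_lebesgue D L = completion (star_measure D L)"

lemma space_star_borel [simp]: "space (star_borel D L) = star D L"
  unfolding star_borel_def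
  by (rule space_measure_of) (use openin_subset in fastforce)

text \<open>
  \<open>distr\<close> is only meaningful along measurable maps, so this is needed for \<open>star_measure\<close> to be the
  length measure.
\<close>

lemma measurable_star_point:
  "(\<lambda>(j, x). star_point j x) \<in>
     restrict_space (count_space UNIV \<Otimes>\<^sub>M lborel) (star_edges D L) \<rightarrow>\<^sub>M star_borel D L"
proof -
  interpret Metric_space "star D L" star_dist by (rule Metric_space_star)
  let ?N = "count_space UNIV \<Otimes>\<^sub>M lborel :: (nat \<times> real) measure"
  have edges: "star_edges D L \<in> sets ?N"
  proof -
    have "star_edges D L = (\<Union>j\<in>{1..D}. {j} \<times> {0..<L j})"
      by (auto simp: star_edges_def)
    then show ?thesis by auto
  qed
  have main: "(\<lambda>(j, x). star_point j x) -` U \<inter> star_edges D L \<in> sets ?N"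
    if U: "openin (star_topology D L) U" for U
  proof -
    have "{x \<in> {0..<L j}. star_point j x \<in> U} \<in> sets borel" if j: "j \<in> {1..D}" for j
    proof -
      have "openin (top_of_set {0..<L j}) {x \<in> {0..<L j}. star_point j x \<in> U}"
        unfolding openin_euclidean_subtopology_iff
      proof (intro conjI ballI)
        fix x assume x: "x \<in> {x \<in> {0..<L j}. star_point j x \<in> U}"
        then obtain r where r: "r > 0" "mball (star_point j x) r \<subseteq> U"
          using U unfolding star_topology_def openin_mtopology by blast
        have "star_point j y \<in> U" if y: "y \<in> {0..<L j}" "dist y x < r" for y
        proof -
          have "star_point j x \<in> star D L" "star_point j y \<in> star D L"
            using x y j by (force simp: star_def star_edges_def)+
          moreover have "star_dist (star_point j x) (star_point j y) < r"
            using x y by (simp add: star_dist_star_point dist_real_def abs_minus_commute)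
          ultimately have "star_point j y \<in> mball (star_point j x) r"
            by simp
          with r(2) show ?thesis by blast
        qed
        then show "\<exists>e>0. \<forall>y\<in>{0..<L j}. dist y x < e \<longrightarrow> y \<in> {x \<in> {0..<L j}. star_point j x \<in> U}"
          using r(1) by blast
      qed auto
      then obtain T where "open T" "{x \<in> {0..<L j}. star_point j x \<in> U} = {0..<L j} \<inter> T"
        by (auto simp: openin_open)
      then show ?thesis by simp
    qed
    moreover have "(\<lambda>(j, x). star_point j x) -` U \<inter> star_edges D L =
        (\<Union>j\<in>{1..D}. {j} \<times> {x \<in> {0..<L j}. star_point j x \<in> U})"
      by (auto simp: star_edges_def)
    ultimately show ?thesis
      by (auto intro!: sets.finite_UN pair_measureI)
  qed
  have sp: "space (restrict_space ?N (star_edges D L)) = star_edges D L"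
    by (simp add: space_restrict_space space_pair_measure)
  show ?thesis
    unfolding star_borel_def
  proof (rule measurable_measure_of)
    show "{U. openin (star_topology D L) U} \<subseteq> Pow (star D L)"
      using openin_subset by fastforce
    show "(\<lambda>(j, x). star_point j x) \<in> space (restrict_space ?N (star_edges D L)) \<rightarrow> star D L"
      unfolding sp by (auto simp: star_def)
    fix U assume "U \<in> {U. openin (star_topology D L) U}"
    then show "(\<lambda>(j, x). star_point j x) -` U \<inter> space (restrict_space ?N (star_edges D L))
        \<in> sets (restrict_space ?N (star_edges D L))"
      using main edges unfolding sp by (auto simp: sets_restrict_space_iff)
  qed
qed

definition star_L1_norm :: "nat \<Rightarrow> (nat \<Rightarrow> real) \<Rightarrow> (nat \<times> real \<Rightarrow> real) \<Rightarrow> real"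
  where "star_L1_norm D L f = (\<integral>p. \<bar>f p\<bar> \<partial>star_lebesgue D L)"

definition star_Linf_norm :: "nat \<Rightarrow> (nat \<Rightarrow> real) \<Rightarrow> (nat \<times> real \<Rightarrow> real) \<Rightarrow> real"
  where "star_Linf_norm D L f = real_of_ereal (esssup (star_lebesgue D L) (\<lambda>p. ereal \<bar>f p\<bar>))"


section \<open>Effective nodal sets\<close>

definition pos_set :: "'a topology \<Rightarrow> ('a \<Rightarrow> real) \<Rightarrow> 'a set"
  where "pos_set X f = {p \<in> topspace X. f p > 0}"

definition neg_set :: "'a topology \<Rightarrow> ('a \<Rightarrow> real) \<Rightarrow> 'a set"
  where "neg_set X f = {p \<in> topspace X. f p < 0}"

definition zero_set :: "'a topology \<Rightarrow> ('a \<Rightarrow> real) \<Rightarrow> 'a set"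
  where "zero_set X f = {p \<in> topspace X. f p = 0}"

definition nodal_points :: "'a topology \<Rightarrow> ('a \<Rightarrow> real) \<Rightarrow> 'a set"
  where "nodal_points X f = X frontier_of pos_set X f \<inter> X frontier_of neg_set X f"

definition nodal_components :: "'a topology \<Rightarrow> ('a \<Rightarrow> real) \<Rightarrow> 'a set set"
  where "nodal_components X f =
    {J \<in> connected_components_of (subtopology X (zero_set X f)).
       X closure_of J \<inter> X frontier_of pos_set X f \<noteq> {} \<and>
       X closure_of J \<inter> X frontier_of neg_set X f \<noteq> {}}"

text \<open>
  The effective nodal set depends on the choice of one point in each nodal component, so it is
  rendered as a predicate that holds of every set arising from such a choice.
\<close>

definition effective_nodal_set :: "'a topology \<Rightarrow> ('a \<Rightarrow> real) \<Rightarrow> 'a set \<Rightarrow> bool"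
  where "effective_nodal_set X f Z \<longleftrightarrow>
    (\<exists>c. (\<forall>J\<in>nodal_components X f. c J \<in> J) \<and> Z = nodal_points X f \<union> c ` nodal_components X f)"


section \<open>Wasserstein distance\<close>

definition coupling :: "'a measure \<Rightarrow> 'b measure \<Rightarrow> ('a \<times> 'b) measure \<Rightarrow> bool"
  where "coupling \<mu> \<nu> \<gamma> \<longleftrightarrow>
    sets \<gamma> = sets (\<mu> \<Otimes>\<^sub>M \<nu>) \<and> distr \<gamma> \<mu> fst = \<mu> \<and> distr \<gamma> \<nu> snd = \<nu>"

definition wasserstein1 :: "('a \<Rightarrow> 'a \<Rightarrow> real) \<Rightarrow> 'a measure \<Rightarrow> 'a measure \<Rightarrow> ennreal"
  where "wasserstein1 d \<mu> \<nu> =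
    (INF \<gamma>\<in>{\<gamma>. coupling \<mu> \<nu> \<gamma>}. \<integral>\<^sup>+ (p, q). ennreal (d p q) \<partial>\<gamma>)"

text \<open>
  A function that is only Lebesgue measurable gives a density with respect to the completed measure;
  \<open>distr\<close> along the identity restricts the result to the Borel sets, where couplings live.
\<close>

definition star_density :: "nat \<Rightarrow> (nat \<Rightarrow> real) \<Rightarrow> (nat \<times> real \<Rightarrow> real) \<Rightarrow> (nat \<times> real) measure"
  where "star_density D L g =
    distr (density (star_lebesgue D L) (\<lambda>p. ennreal (g p))) (star_borel D L) (\<lambda>p. p)"

definition pos_part :: "('a \<Rightarrow> real) \<Rightarrow> 'a \<Rightarrow> real"
  where "pos_part f p = max (f p) 0"

definition neg_part :: "('a \<Rightarrow> real) \<Rightarrow> 'a \<Rightarrow> real"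
  where "neg_part f p = - max (- f p) 0"

definition star_W1 :: "nat \<Rightarrow> (nat \<Rightarrow> real) \<Rightarrow> (nat \<times> real \<Rightarrow> real) \<Rightarrow> ennreal"
  where "star_W1 D L f =
    wasserstein1 star_dist (star_density D L (pos_part f)) (star_density D L (\<lambda>p. \<bar>neg_part f p\<bar>))"

end

theory Submission
  imports Defs
begin

text \<open>
  Let \<open>M\<close> be the supremum norm and \<open>A\<close> the \<open>L\<^sup>1\<close> norm of \<open>f\<close>, and let \<open>F\<close> be the flux: at a point of
  an edge, \<open>F\<close> is the integral of \<open>f\<close> over the part of the edge beyond it. On a tree the transport cost
  is the integral of \<open>\<bar>F\<bar>\<close>, and a Kantorovich potential with slope \<open>sgn F\<close> shows that it is at least that
  (\<open>star_W1_ge_flux\<close>). Since \<open>\<bar>f\<bar> \<le> M\<close> almost everywhere and \<open>f\<close> is minus the derivative of \<open>F\<close>,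
  \<open>M\<close> times the cost is at least the integral of \<open>\<bar>F\<bar> * \<bar>F'\<bar>\<close>, the total variation of
  \<open>F * \<bar>F\<bar> / 2\<close>, while \<open>A\<close> is the total variation of \<open>F\<close>. It remains to compare these two variations for
  functions on the edges with few monotone pieces, which vanish at the free ends and whose values at the
  vertex add up to zero.

  A number \<open>r > 0\<close> linearises the comparison: the claim follows, with \<open>r = A / (2 * N)\<close>, from the bound
  \<open>- N * r\<^sup>2\<close> for the integral of \<open>(\<bar>F\<bar> - r) * \<bar>F'\<bar>\<close>, where \<open>N\<close> is the factor that
  multiplies the distance in the theorem.
  Along each edge, a sign change of \<open>f\<close> is an extremum of \<open>F\<close> and loses at most \<open>r\<^sup>2\<close>
  (\<open>flux_excess_lower\<close>); what is left is \<open>v\<^sup>2 / 2 - r * \<bar>v\<bar>\<close> for the flux \<open>v\<close> at the vertex. The sum of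
  these terms over the edges, subject to the fluxes adding up to zero, is at least \<open>- r\<^sup>2\<close> times \<open>D / 2\<close>
  or \<open>(D + 1) * (D - 1) / (2 * D)\<close>, according to the parity of \<open>D\<close>
  (\<open>sum_half_excess_lower\<close>). If the vertex is one of the sign changes, this is the claim. Otherwise \<open>f\<close>
  has one sign near the vertex, and on the edges whose flux at the vertex has the opposite sign the modulus of the flux
  first increases, which makes up for the additional sign change inside an edge
  (\<open>sum_excess_lower_inward\<close>).

  The topological part provides the sign changes: \<open>separating_set_exists\<close> replaces the effective nodal
  set by one with at most as many points that every geodesic between opposite signs meets.
\<close>

section \<open>The flux of a bounded density on an interval\<close>

text \<open>
  The flux below is only Lipschitz, so it is differentiable merely almost everywhere. Increments of
  second order make the derivative vanish at every point, which is what lets the fundamental theorem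
  of calculus be avoided.
\<close>

lemma quadratic_increments_const:
  fixes \<Phi> :: "real \<Rightarrow> real"
  assumes "a \<le> b" and C: "\<And>x y. x \<in> {a..b} \<Longrightarrow> y \<in> {a..b} \<Longrightarrow> x \<le> y \<Longrightarrow> \<bar>\<Phi> x - \<Phi> y\<bar> \<le> C * (y - x)\<^sup>2"
  shows "\<Phi> a = \<Phi> b"
proof -
  have C': "\<bar>\<Phi> y - \<Phi> x\<bar> \<le> C * (y - x)\<^sup>2" if "x \<in> {a..b}" "y \<in> {a..b}" for x y
    using C[OF that] C[OF that(2,1)] by (cases "x \<le> y") (auto simp: abs_minus_commute power2_commute)
  have "(\<Phi> has_field_derivative 0) (at x within {a..b})" if x: "x \<in> {a..b}" for x
    unfolding has_field_derivative_iff
  proof (rule Lim_null_comparison)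
    show "\<forall>\<^sub>F y in at x within {a..b}. norm ((\<Phi> y - \<Phi> x) / (y - x)) \<le> \<bar>C\<bar> * \<bar>y - x\<bar>"
      unfolding eventually_at_filter
    proof (rule always_eventually, safe)
      fix y assume y: "y \<noteq> x" "y \<in> {a..b}"
      have "\<bar>\<Phi> y - \<Phi> x\<bar> \<le> \<bar>C\<bar> * (y - x)\<^sup>2"
        using C'[OF x y(2)] mult_right_mono[OF abs_ge_self[of C], of "(y - x)\<^sup>2"] by simp
      also have "\<dots> = (\<bar>C\<bar> * \<bar>y - x\<bar>) * \<bar>y - x\<bar>"
        by (simp add: power2_eq_square)
      finally show "norm ((\<Phi> y - \<Phi> x) / (y - x)) \<le> \<bar>C\<bar> * \<bar>y - x\<bar>"
        using y(1) by (simp add: field_simps)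
    qed
    show "((\<lambda>y. \<bar>C\<bar> * \<bar>y - x\<bar>) \<longlongrightarrow> 0) (at x within {a..b})"
      by (rule tendsto_eq_intros | simp)+
  qed
  then obtain c where "\<And>x. x \<in> {a..b} \<Longrightarrow> \<Phi> x = c"
    using has_field_derivative_zero_constant[of "{a..b}" \<Phi>] by auto
  then show ?thesis using \<open>a \<le> b\<close> by auto
qed

lemma bounded_borel_integrable_on:
  fixes f :: "real \<Rightarrow> real"
  assumes "f \<in> borel_measurable borel" and "\<And>x. \<bar>f x\<bar> \<le> K"
  shows "f integrable_on {a..b}"
proof -
  have "set_integrable lborel {a..b} f"
    unfolding set_integrable_def
    by (rule integrableI_bounded_set[where A="{a..b}" and B=K])
       (use assms in \<open>auto simp: indicator_def emeasure_lborel_Icc_eq\<close>)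
  then show ?thesis by (rule set_borel_integral_eq_integral)
qed

text \<open>
  On an edge, with the vertex at \<open>0\<close> and the free end at \<open>L\<close>, this is the net mass that every transport
  plan has to carry across the point \<open>x\<close>.
\<close>

definition flux :: "real \<Rightarrow> (real \<Rightarrow> real) \<Rightarrow> real \<Rightarrow> real"
  where "flux L f x = integral {x..L} f"

lemma flux_end [simp]: "flux L f L = 0"
  by (simp add: flux_def)

lemma flux_diff:
  assumes "f \<in> borel_measurable borel" "\<And>x. \<bar>f x\<bar> \<le> K" "x \<le> y" "y \<le> L"
  shows "flux L f x - flux L f y = integral {x..y} f"
  using Henstock_Kurzweil_Integration.integral_combine[OF assms(3,4) bounded_borel_integrable_on[OF assms(1,2)]]
  by (simp add: flux_def)

lemma integral_abs_le:
  fixes g :: "real \<Rightarrow> real"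
  assumes "g integrable_on {x..y}" "\<And>u. u \<in> {x..y} \<Longrightarrow> \<bar>g u\<bar> \<le> B" "x \<le> y"
  shows "\<bar>integral {x..y} g\<bar> \<le> B * (y - x)"
proof -
  have "norm (integral {x..y} g) \<le> integral {x..y} (\<lambda>_. B)"
    by (rule integral_norm_bound_integral) (use assms in auto)
  then show ?thesis using assms(3) by (simp add: mult.commute)
qed

lemma flux_lipschitz:
  assumes "f \<in> borel_measurable borel" "\<And>x. \<bar>f x\<bar> \<le> K"
  shows "\<bar>flux L f x - flux L f y\<bar> \<le> K * \<bar>x - y\<bar>"
proof -
  have K: "K \<ge> 0" using assms(2)[of 0] by simp
  have 1: "\<bar>flux L f x - flux L f y\<bar> \<le> K * \<bar>x - y\<bar>" if "x \<le> y" "y \<le> L" for x y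
    using integral_abs_le[OF bounded_borel_integrable_on[OF assms], of x y] assms(2) that
    by (simp add: flux_diff[OF assms that])
  have 2: "flux L f x = flux L f (min x L)" for x
    by (auto simp: flux_def min_def)
  have 3: "\<bar>flux L f x - flux L f y\<bar> \<le> K * \<bar>x - y\<bar>" if "x \<le> y" for x y
  proof -
    have "\<bar>flux L f (min x L) - flux L f (min y L)\<bar> \<le> K * \<bar>min x L - min y L\<bar>"
      by (rule 1) (use that in auto)
    also have "\<dots> \<le> K * \<bar>x - y\<bar>" by (rule mult_left_mono) (use K in auto)
    finally show ?thesis using 2 by metis
  qed
  show ?thesis using 3[of x y] 3[of y x] by (cases "x \<le> y") (auto simp: abs_minus_commute)
qed

lemma continuous_flux:
  assumes "f \<in> borel_measurable borel" "\<And>x. \<bar>f x\<bar> \<le> K"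
  shows "continuous_on S (flux L f)"
proof -
  have "K \<ge> 0" using assms(2)[of 0] by simp
  then have "K-lipschitz_on S (flux L f)"
    using flux_lipschitz[OF assms] by (auto simp: lipschitz_on_def dist_real_def)
  then show ?thesis by (rule lipschitz_on_continuous_on)
qed

lemma borel_measurable_flux:
  assumes "f \<in> borel_measurable borel" "\<And>x. \<bar>f x\<bar> \<le> K"
  shows "flux L f \<in> borel_measurable borel"
  by (rule borel_measurable_continuous_onI[OF continuous_flux[OF assms]])

lemma integrable_comp_flux_times:
  fixes G' :: "real \<Rightarrow> real"
  assumes f: "f \<in> borel_measurable borel" "\<And>x. \<bar>f x\<bar> \<le> K"
    and p: "p \<in> borel_measurable borel" "\<And>x. \<bar>p x\<bar> \<le> K'"
    and G': "continuous_on UNIV G'"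
  shows "(\<lambda>x. G' (flux L f x) * p x) integrable_on {a..b}"
proof -
  have c: "continuous_on {a..b} (\<lambda>x. G' (flux L f x))"
    using continuous_on_compose2[OF G' continuous_flux[OF f]] by simp
  have "set_integrable lborel {a..b} (\<lambda>x. G' (flux L f x) * p x)"
    unfolding set_integrable_def
  proof -
    have "compact ((\<lambda>x. G' (flux L f x)) ` {a..b})"
      by (rule compact_continuous_image[OF c]) simp
    then obtain B where B: "\<And>x. x \<in> {a..b} \<Longrightarrow> \<bar>G' (flux L f x)\<bar> \<le> B"
      by (metis (no_types, lifting) bounded_iff compact_imp_bounded image_eqI real_norm_def)
    have m: "(\<lambda>x. G' (flux L f x)) \<in> borel_measurable borel"
      by (intro borel_measurable_continuous_onI continuous_on_compose2[OF G' continuous_flux[OF f]]) simp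
    show "integrable lborel (\<lambda>x. indicat_real {a..b} x *\<^sub>R (G' (flux L f x) * p x))"
    proof (rule integrableI_bounded_set[where A="{a..b}" and B="B * K'"])
      show "(\<lambda>x. indicat_real {a..b} x *\<^sub>R (G' (flux L f x) * p x)) \<in> borel_measurable lborel"
        using m p(1) by simp
      show "AE x\<in>{a..b} in lborel. norm (indicat_real {a..b} x *\<^sub>R (G' (flux L f x) * p x)) \<le> B * K'"
      proof (rule AE_I2, rule impI)
        fix x assume "x \<in> {a..b}"
        then show "norm (indicat_real {a..b} x *\<^sub>R (G' (flux L f x) * p x)) \<le> B * K'"
          using mult_mono[OF B p(2)] B[of x] by (simp add: abs_mult)
      qed
    qed (auto simp: emeasure_lborel_Icc_eq)
  qed
  then show ?thesis by (rule set_borel_integral_eq_integral)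
qed

text \<open>
  The flux has derivative \<open>- f\<close> almost everywhere. Since \<open>f\<close> is bounded, the increments of the two
  sides over \<open>[x, y]\<close>, as functions of the left end point, differ by at most a constant times
  \<open>(y - x)\<^sup>2\<close>.
\<close>

lemma chain_rule_flux:
  fixes G G' :: "real \<Rightarrow> real"
  assumes f: "f \<in> borel_measurable borel" "\<And>x. \<bar>f x\<bar> \<le> K"
    and G: "\<And>u v. \<bar>G v - G u - G' u * (v - u)\<bar> \<le> (v - u)\<^sup>2"
    and G': "\<And>u v. \<bar>G' v - G' u\<bar> \<le> \<bar>v - u\<bar>"
    and ab: "a \<le> b" "b \<le> L"
  shows "integral {a..b} (\<lambda>x. G' (flux L f x) * f x) = G (flux L f a) - G (flux L f b)"
proof -
  let ?F = "flux L f"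
  let ?p = "\<lambda>x. G' (?F x) * f x"
  have K: "K \<ge> 0" using f(2)[of 0] by simp
  have "1-lipschitz_on UNIV G'" using G' by (auto simp: lipschitz_on_def dist_real_def)
  then have cG': "continuous_on UNIV G'" by (rule lipschitz_on_continuous_on)
  have int: "?p integrable_on {x..y}" for x y
    by (rule integrable_comp_flux_times[OF f f cG'])
  define \<Phi> where "\<Phi> x = integral {x..b} ?p - G (?F x)" for x
  have "\<Phi> a = \<Phi> b"
  proof (rule quadratic_increments_const[where C="2 * K\<^sup>2", OF ab(1)])
    fix x y assume xy: "x \<in> {a..b}" "y \<in> {a..b}" "x \<le> y"
    have d: "?F x - ?F y = integral {x..y} f" using flux_diff[OF f] xy ab by auto
    have "integral {x..b} ?p = integral {x..y} ?p + integral {y..b} ?p"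
      using Henstock_Kurzweil_Integration.integral_combine[of x y b ?p] int xy by auto
    then have "\<Phi> x - \<Phi> y = integral {x..y} ?p - (G (?F x) - G (?F y))" by (simp add: \<Phi>_def)
    also have "integral {x..y} ?p = integral {x..y} (\<lambda>u. (G' (?F u) - G' (?F y)) * f u) + G' (?F y) * (?F x - ?F y)"
    proof -
      have "integral {x..y} (\<lambda>u. ?p u - G' (?F y) * f u) = integral {x..y} ?p - integral {x..y} (\<lambda>u. G' (?F y) * f u)"
        by (rule Henstock_Kurzweil_Integration.integral_diff[OF int]) (intro integrable_on_mult_right bounded_borel_integrable_on[OF f])
      then show ?thesis by (simp add: d left_diff_distrib)
    qed
    finally have e: "\<Phi> x - \<Phi> y = integral {x..y} (\<lambda>u. (G' (?F u) - G' (?F y)) * f u) -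
        (G (?F x) - G (?F y) - G' (?F y) * (?F x - ?F y))" by simp
    have "\<bar>integral {x..y} (\<lambda>u. (G' (?F u) - G' (?F y)) * f u)\<bar> \<le> (K * (y - x) * K) * (y - x)"
    proof (rule integral_abs_le)
      show "(\<lambda>u. (G' (?F u) - G' (?F y)) * f u) integrable_on {x..y}"
        by (rule integrable_comp_flux_times[OF f f, where G'="\<lambda>v. G' v - G' (?F y)"])
           (intro continuous_intros cG')
      fix u assume u: "u \<in> {x..y}"
      have "\<bar>G' (?F u) - G' (?F y)\<bar> \<le> \<bar>?F u - ?F y\<bar>" by (rule G')
      also have "\<dots> \<le> K * \<bar>u - y\<bar>" by (rule flux_lipschitz[OF f])
      also have "\<dots> \<le> K * (y - x)" using u K by (intro mult_left_mono) auto
      finally show "\<bar>(G' (?F u) - G' (?F y)) * f u\<bar> \<le> K * (y - x) * K"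
        unfolding abs_mult using f(2)[of u] K xy by (intro mult_mono) auto
    qed (use xy in auto)
    moreover have "\<bar>G (?F x) - G (?F y) - G' (?F y) * (?F x - ?F y)\<bar> \<le> (K * (y - x))\<^sup>2"
    proof -
      have "\<bar>?F x - ?F y\<bar> \<le> K * (y - x)" using flux_lipschitz[OF f, of L x y] xy by simp
      then have "(?F x - ?F y)\<^sup>2 \<le> (K * (y - x))\<^sup>2" by (rule abs_le_square_iff[THEN iffD1, OF order_trans]) (rule abs_ge_self)
      then show ?thesis using G[of "?F x" "?F y"] by linarith
    qed
    ultimately show "\<bar>\<Phi> x - \<Phi> y\<bar> \<le> 2 * K\<^sup>2 * (y - x)\<^sup>2"
      unfolding e by (simp add: power2_eq_square algebra_simps)
  qed
  then show ?thesis by (simp add: \<Phi>_def)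
qed

text \<open>
  The primitive of the sign of the flux is the optimal Kantorovich potential on an edge, and pairing it
  with \<open>f\<close> gives the transport cost. This is an integration by parts, obtained by polarisation from
  the chain rule for \<open>v\<^sup>2 / 2\<close>.
\<close>

lemma integral_abs_flux_dual:
  assumes f: "f \<in> borel_measurable borel" "\<And>x. \<bar>f x\<bar> \<le> K" and L: "0 \<le> L"
  defines "\<sigma> \<equiv> \<lambda>x. sgn (flux L f x)"
  shows "integral {0..L} (\<lambda>x. integral {0..x} \<sigma> * f x) = integral {0..L} (\<lambda>x. \<bar>flux L f x\<bar>)"
proof -
  let ?F = "flux L f" and ?\<psi> = "flux L \<sigma>"
  have m\<sigma>: "\<sigma> \<in> borel_measurable borel"
    unfolding \<sigma>_def using borel_measurable_flux[OF f] by measurable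
  have b\<sigma>: "\<bar>\<sigma> x\<bar> \<le> 1" for x by (auto simp: \<sigma>_def sgn_if)
  have K: "K \<ge> 0" using f(2)[of 0] by simp
  have half: "integral {0..L} (\<lambda>x. flux L p x * p x) = (flux L p 0)\<^sup>2 / 2"
    if p: "p \<in> borel_measurable borel" "\<And>x. \<bar>p x\<bar> \<le> K'" for p :: "real \<Rightarrow> real" and K'
  proof -
    have *: "\<bar>v\<^sup>2 / 2 - u\<^sup>2 / 2 - u * (v - u)\<bar> \<le> (v - u)\<^sup>2" for u v :: real
    proof -
      have "v\<^sup>2 / 2 - u\<^sup>2 / 2 - u * (v - u) = (v - u)\<^sup>2 / 2" by (simp add: power2_eq_square field_simps)
      then show ?thesis by (simp only:) simp
    qed
    show ?thesis
      using chain_rule_flux[where G="\<lambda>v. v\<^sup>2 / 2" and G'="\<lambda>v. v" and a=0 and b=L and L=L, OF p * _ L]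
      by simp
  qed
  have sum: "flux L (\<lambda>x. f x + \<sigma> x) x = ?F x + ?\<psi> x" and diff: "flux L (\<lambda>x. f x - \<sigma> x) x = ?F x - ?\<psi> x" for x
    unfolding flux_def
    by (intro Henstock_Kurzweil_Integration.integral_add Henstock_Kurzweil_Integration.integral_diff
        bounded_borel_integrable_on[OF f] bounded_borel_integrable_on[OF m\<sigma> b\<sigma>])+
  have bnd: "\<bar>f x + \<sigma> x\<bar> \<le> K + 1" "\<bar>f x - \<sigma> x\<bar> \<le> K + 1" for x
    using f(2)[of x] b\<sigma>[of x] by linarith+
  have i1: "integral {0..L} (\<lambda>x. (?F x + ?\<psi> x) * (f x + \<sigma> x)) = (?F 0 + ?\<psi> 0)\<^sup>2 / 2"
    using half[of "\<lambda>x. f x + \<sigma> x" "K + 1"] bnd f m\<sigma> by (simp add: sum)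
  have i2: "integral {0..L} (\<lambda>x. (?F x - ?\<psi> x) * (f x - \<sigma> x)) = (?F 0 - ?\<psi> 0)\<^sup>2 / 2"
    using half[of "\<lambda>x. f x - \<sigma> x" "K + 1"] bnd f m\<sigma> by (simp add: diff)
  note ii = integrable_comp_flux_times[OF f f, where G'="\<lambda>x. x", OF continuous_on_id]
     integrable_comp_flux_times[OF f m\<sigma> b\<sigma>, where G'="\<lambda>x. x", OF continuous_on_id]
     integrable_comp_flux_times[OF m\<sigma> b\<sigma> f, where G'="\<lambda>x. x", OF continuous_on_id]
     integrable_comp_flux_times[OF m\<sigma> b\<sigma> m\<sigma> b\<sigma>, where G'="\<lambda>x. x", OF continuous_on_id]
  have "integral {0..L} (\<lambda>x. (?F x + ?\<psi> x) * (f x + \<sigma> x)) - integral {0..L} (\<lambda>x. (?F x - ?\<psi> x) * (f x - \<sigma> x))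
     = integral {0..L} (\<lambda>x. (?F x + ?\<psi> x) * (f x + \<sigma> x) - (?F x - ?\<psi> x) * (f x - \<sigma> x))"
    by (rule Henstock_Kurzweil_Integration.integral_diff[symmetric])
       (simp_all add: ring_distribs Henstock_Kurzweil_Integration.integrable_add Henstock_Kurzweil_Integration.integrable_diff ii)
  also have "\<dots> = integral {0..L} (\<lambda>x. 2 * (?F x * \<sigma> x + ?\<psi> x * f x))"
    by (simp add: algebra_simps)
  also have "\<dots> = 2 * (integral {0..L} (\<lambda>x. ?F x * \<sigma> x) + integral {0..L} (\<lambda>x. ?\<psi> x * f x))"
    by (simp only: integral_mult_right Henstock_Kurzweil_Integration.integral_add[OF ii(2,3)])
  finally have prod: "integral {0..L} (\<lambda>x. ?F x * \<sigma> x) + integral {0..L} (\<lambda>x. ?\<psi> x * f x) = ?F 0 * ?\<psi> 0"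
    unfolding i1 i2 by (simp add: power2_eq_square field_simps)
  have "integral {0..L} (\<lambda>x. integral {0..x} \<sigma> * f x) = integral {0..L} (\<lambda>x. ?\<psi> 0 * f x - ?\<psi> x * f x)"
  proof (rule Henstock_Kurzweil_Integration.integral_cong)
    fix x assume "x \<in> {0..L}"
    then have "integral {0..x} \<sigma> = ?\<psi> 0 - ?\<psi> x" by (subst flux_diff[OF m\<sigma> b\<sigma>]) auto
    then show "integral {0..x} \<sigma> * f x = ?\<psi> 0 * f x - ?\<psi> x * f x" by (simp only: left_diff_distrib)
  qed
  also have "\<dots> = ?\<psi> 0 * ?F 0 - integral {0..L} (\<lambda>x. ?\<psi> x * f x)"
    by (subst Henstock_Kurzweil_Integration.integral_diff)
       (simp_all add: ii(3) integrable_on_mult_right bounded_borel_integrable_on[OF f] flux_def[of L f 0])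
  also have "\<dots> = integral {0..L} (\<lambda>x. ?F x * \<sigma> x)" using prod by (simp add: mult.commute)
  also have "\<dots> = integral {0..L} (\<lambda>x. \<bar>?F x\<bar>)"
    by (rule Henstock_Kurzweil_Integration.integral_cong) (simp add: \<sigma>_def abs_sgn)
  finally show ?thesis .
qed

section \<open>Excess of the flux and sign changes\<close>

text \<open>
  The number \<open>r\<close> is a Lagrange multiplier: where the flux is below \<open>r\<close> in absolute value the integrand
  is negative, and the whole argument consists in bounding how much can be lost there.
\<close>

definition flux_excess :: "real \<Rightarrow> real \<Rightarrow> (real \<Rightarrow> real) \<Rightarrow> real \<Rightarrow> real"
  where "flux_excess r L f t = integral {t..L} (\<lambda>x. (\<bar>flux L f x\<bar> - r) * \<bar>f x\<bar>)"

text \<open>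
  This is the integral of \<open>u - r\<close> over \<open>0 < u < \<bar>v\<bar>\<close>, the excess along a monotone flux between \<open>v\<close>
  and \<open>0\<close>.
\<close>

definition half_excess :: "real \<Rightarrow> real \<Rightarrow> real"
  where "half_excess r v = v\<^sup>2 / 2 - r * \<bar>v\<bar>"

lemma flux_uminus [simp]: "flux L (\<lambda>x. - f x) x = - flux L f x"
  by (simp add: flux_def)

lemma flux_excess_uminus [simp]: "flux_excess r L (\<lambda>x. - f x) t = flux_excess r L f t"
  by (simp add: flux_excess_def)

lemma half_excess_uminus [simp]: "half_excess r (- v) = half_excess r v"
  by (simp add: half_excess_def)

text \<open>
  Where \<open>f \<ge> 0\<close>, the integrand is \<open>\<bar>F\<bar> - r\<close> times \<open>- F'\<close>, with primitive \<open>- (F * \<bar>F\<bar> / 2 - r * F)\<close>.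
\<close>

lemma flux_excess_step:
  assumes f: "f \<in> borel_measurable borel" "\<And>x. \<bar>f x\<bar> \<le> K"
    and tz: "t \<le> z" "z \<le> L" and pos: "\<And>x. x \<in> {t<..<z} \<Longrightarrow> f x \<ge> 0"
  defines "u \<equiv> flux L f t" and "v \<equiv> flux L f z"
  shows "v \<le> u" and "flux_excess r L f t =
    flux_excess r L f z + (u * \<bar>u\<bar> / 2 - v * \<bar>v\<bar> / 2 - r * (u - v))"
proof -
  let ?p = "\<lambda>x. (\<bar>flux L f x\<bar> - r) * \<bar>f x\<bar>"
  have abs_f: "\<bar>f x\<bar> = f x" if "x \<in> {t..z} - {t, z}" for x
    using pos[of x] that by auto
  have "u - v = integral {t..z} f" unfolding u_def v_def by (rule flux_diff[OF f tz])
  also have "\<dots> = integral {t..z} (\<lambda>x. \<bar>f x\<bar>)"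
    by (rule integral_spike[where S="{t, z}"]) (simp_all add: abs_f)
  also have "\<dots> \<ge> 0" by (rule integral_nonneg) (use bounded_borel_integrable_on[of "\<lambda>x. \<bar>f x\<bar>" K] f in auto)
  finally show "v \<le> u" by simp
  have int: "?p integrable_on {a..b}" for a b
    by (rule integrable_comp_flux_times[OF f, where G'="\<lambda>v. \<bar>v\<bar> - r" and K'=K])
       (use f in \<open>auto intro!: continuous_intros\<close>)
  have "flux_excess r L f t = integral {t..z} ?p + flux_excess r L f z"
    unfolding flux_excess_def
    using Henstock_Kurzweil_Integration.integral_combine[of t z L ?p] int tz by auto
  also have "integral {t..z} ?p = integral {t..z} (\<lambda>x. (\<bar>flux L f x\<bar> - r) * f x)"
    by (rule integral_spike[where S="{t, z}"]) (simp_all add: abs_f)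
  also have "\<dots> = (u * \<bar>u\<bar> / 2 - r * u) - (v * \<bar>v\<bar> / 2 - r * v)"
    unfolding u_def v_def
  proof (rule chain_rule_flux[OF f _ _ tz])
    fix u v :: real
    have 1: "\<bar>v * \<bar>v\<bar> / 2 - u * \<bar>u\<bar> / 2 - \<bar>u\<bar> * (v - u)\<bar> \<le> (v - u)\<^sup>2"
    proof -
      have c: "0 \<le> u * u" "0 \<le> v * v" "0 \<le> (v - u) * (v - u)" by simp_all
      consider "u \<ge> 0" "v \<ge> 0" | "u < 0" "v < 0" | "u \<ge> 0" "v < 0" | "u < 0" "v \<ge> 0" by linarith
      then show ?thesis
      proof cases
        case 3
        then have "u * v \<le> 0" by (simp add: mult_nonneg_nonpos)
        moreover have "v * \<bar>v\<bar> / 2 - u * \<bar>u\<bar> / 2 - \<bar>u\<bar> * (v - u) = (u * u) / 2 - u * v - (v * v) / 2"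
          using 3 by (simp add: field_simps)
        moreover have "(v - u)\<^sup>2 = v * v - 2 * (u * v) + u * u"
          by (simp add: power2_eq_square algebra_simps)
        ultimately show ?thesis using c(1,2) by (simp only: abs_le_iff) linarith
      next
        case 4
        then have "u * v \<le> 0" by (simp add: mult_nonpos_nonneg)
        moreover have "v * \<bar>v\<bar> / 2 - u * \<bar>u\<bar> / 2 - \<bar>u\<bar> * (v - u) = (v * v) / 2 + u * v - (u * u) / 2"
          using 4 by (simp add: field_simps)
        moreover have "(v - u)\<^sup>2 = v * v - 2 * (u * v) + u * u"
          by (simp add: power2_eq_square algebra_simps)
        ultimately show ?thesis using c(1,2) by (simp only: abs_le_iff) linarith
      qed (use c in \<open>simp_all add: abs_le_iff power2_eq_square algebra_simps\<close>)
    qed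
    then show "\<bar>(v * \<bar>v\<bar> / 2 - r * v) - (u * \<bar>u\<bar> / 2 - r * u) - (\<bar>u\<bar> - r) * (v - u)\<bar> \<le> (v - u)\<^sup>2"
      by (simp add: algebra_simps)
  qed auto
  finally show "flux_excess r L f t =
    flux_excess r L f z + (u * \<bar>u\<bar> / 2 - v * \<bar>v\<bar> / 2 - r * (u - v))"
    by (simp add: algebra_simps)
qed

text \<open>
  One monotone piece of the flux costs at most \<open>r\<^sup>2\<close>: as \<open>u\<^sup>2 / 2 - r * u\<close> is at least \<open>- r\<^sup>2 / 2\<close>,
  a local extremum of the flux loses at most \<open>r\<^sup>2 / 2\<close> on each of its two sides. On the last piece
  before the free end, where the flux is \<open>0\<close>, nothing is lost.
\<close>

lemma flux_excess_step_bound: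
  assumes f: "f \<in> borel_measurable borel" "\<And>x. \<bar>f x\<bar> \<le> K"
    and tz: "t \<le> z" "z \<le> L"
    and sgn: "(\<forall>x\<in>{t<..<z}. f x \<ge> 0) \<or> (\<forall>x\<in>{t<..<z}. f x \<le> 0)"
  shows "half_excess r (flux L f t) - r\<^sup>2
    \<le> flux_excess r L f t - flux_excess r L f z + half_excess r (flux L f z)"
    and "flux L f z = 0 \<Longrightarrow> half_excess r (flux L f t) \<le> flux_excess r L f t - flux_excess r L f z"
proof -
  have alg: "half_excess r u - r\<^sup>2 \<le> (u * \<bar>u\<bar> / 2 - v * \<bar>v\<bar> / 2 - r * (u - v)) + half_excess r v"
    if "v \<le> u" for u v
  proof -
    consider "v \<ge> 0" | "u \<le> 0" | "v < 0" "u > 0" by linarith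
    then show ?thesis
    proof cases
      case 1
      then show ?thesis using that by (simp add: half_excess_def power2_eq_square algebra_simps)
    next
      case 2
      have "(u + r)\<^sup>2 \<le> (v + r)\<^sup>2 + r\<^sup>2"
      proof (cases "u + 2 * r \<ge> 0")
        case True
        have "u * (u + 2 * r) \<le> 0" using True 2 by (simp add: mult_nonpos_nonneg)
        moreover have "0 \<le> (v + r)\<^sup>2" by simp
        ultimately show ?thesis by (simp add: power2_eq_square algebra_simps)
      next
        case False
        then have "\<bar>u + r\<bar> \<le> \<bar>v + r\<bar> \<or> r < 0" using that by linarith
        then show ?thesis
        proof
          assume "\<bar>u + r\<bar> \<le> \<bar>v + r\<bar>"
          then have "(u + r)\<^sup>2 \<le> (v + r)\<^sup>2" by (simp add: abs_le_square_iff)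
          then show ?thesis by (simp add: add_increasing2)
        next
          assume r: "r < 0"
          then have "\<bar>u + r\<bar> \<le> \<bar>v + r\<bar>" using 2 that by linarith
          then have "(u + r)\<^sup>2 \<le> (v + r)\<^sup>2" by (simp add: abs_le_square_iff)
          then show ?thesis by (simp add: add_increasing2)
        qed
      qed
      then show ?thesis using 2 that by (simp add: half_excess_def power2_eq_square algebra_simps)
    next
      case 3
      have "0 \<le> (v + r)\<^sup>2" by simp
      with 3 show ?thesis by (simp add: half_excess_def power2_eq_square algebra_simps)
    qed
  qed
  have alg0: "half_excess r u \<le> u * \<bar>u\<bar> / 2 - r * u" if "0 \<le> u" for u
    using that by (simp add: half_excess_def power2_eq_square)
  have *: "half_excess r (flux L p t) - r\<^sup>2
    \<le> flux_excess r L p t - flux_excess r L p z + half_excess r (flux L p z) \<and>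
    (flux L p z = 0 \<longrightarrow> half_excess r (flux L p t) \<le> flux_excess r L p t - flux_excess r L p z)"
    if p: "p \<in> borel_measurable borel" "\<And>x. \<bar>p x\<bar> \<le> K" and pos: "\<And>x. x \<in> {t<..<z} \<Longrightarrow> p x \<ge> 0"
    for p
    using flux_excess_step[OF p tz pos] alg[of "flux L p z" "flux L p t"] alg0[of "flux L p t"] by auto
  have "half_excess r (flux L f t) - r\<^sup>2
    \<le> flux_excess r L f t - flux_excess r L f z + half_excess r (flux L f z) \<and>
    (flux L f z = 0 \<longrightarrow> half_excess r (flux L f t) \<le> flux_excess r L f t - flux_excess r L f z)"
    using sgn
  proof
    assume "\<forall>x\<in>{t<..<z}. f x \<ge> 0"
    then show ?thesis using *[OF f] by auto
  next
    assume "\<forall>x\<in>{t<..<z}. f x \<le> 0"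
    then show ?thesis using *[of "\<lambda>x. - f x"] f by auto
  qed
  then show "half_excess r (flux L f t) - r\<^sup>2
    \<le> flux_excess r L f t - flux_excess r L f z + half_excess r (flux L f z)"
    and "flux L f z = 0 \<Longrightarrow> half_excess r (flux L f t) \<le> flux_excess r L f t - flux_excess r L f z"
    by auto
qed

text \<open>
  Superfluous points are admitted in \<open>W\<close>, because an effective nodal set may contain points with
  the same sign of \<open>f\<close> on both sides.
\<close>

definition sign_changes_in :: "real set \<Rightarrow> real \<Rightarrow> (real \<Rightarrow> real) \<Rightarrow> bool"
  where "sign_changes_in W L f \<longleftrightarrow>
    (\<forall>a b. 0 \<le> a \<longrightarrow> b \<le> L \<longrightarrow> {a<..<b} \<inter> W = {} \<longrightarrow>
      (\<forall>x\<in>{a<..<b}. f x \<ge> 0) \<or> (\<forall>x\<in>{a<..<b}. f x \<le> 0))"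

text \<open>
  Induction over the sign changes, from the free end towards the vertex.
\<close>

lemma flux_excess_lower:
  assumes f: "f \<in> borel_measurable borel" "\<And>x. \<bar>f x\<bar> \<le> K"
    and W: "finite W" "sign_changes_in W L f" and t: "0 \<le> t" "t \<le> L"
  shows "half_excess r (flux L f t) - real (card (W \<inter> {t<..<L})) * r\<^sup>2 \<le> flux_excess r L f t"
  using t
proof (induction "card (W \<inter> {t<..<L})" arbitrary: t rule: less_induct)
  case less
  let ?S = "W \<inter> {t<..<L}"
  have fin: "finite ?S" using W(1) by simp
  show ?case
  proof (cases "?S = {}")
    case True
    then have "(\<forall>x\<in>{t<..<L}. f x \<ge> 0) \<or> (\<forall>x\<in>{t<..<L}. f x \<le> 0)"
      using W(2) less.prems unfolding sign_changes_in_def by blast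
    from flux_excess_step_bound(2)[OF f less.prems(2) order_refl this, of r] True
    show ?thesis by (simp add: flux_excess_def)
  next
    case False
    define z where "z = Min ?S"
    have z: "z \<in> ?S" unfolding z_def by (rule Min_in[OF fin False])
    have "x \<notin> ?S" if "x < z" for x using Min_le[OF fin, of x] that unfolding z_def by auto
    then have "{t<..<z} \<inter> W = {}" using z by fastforce
    then have sgn: "(\<forall>x\<in>{t<..<z}. f x \<ge> 0) \<or> (\<forall>x\<in>{t<..<z}. f x \<le> 0)"
      using W(2) less.prems z unfolding sign_changes_in_def by auto
    have sub: "insert z (W \<inter> {z<..<L}) \<subseteq> ?S" using z by auto
    have "Suc (card (W \<inter> {z<..<L})) = card (insert z (W \<inter> {z<..<L}))" using W(1) by simp
    also have "\<dots> \<le> card ?S" by (rule card_mono[OF fin sub])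
    finally have c: "Suc (card (W \<inter> {z<..<L})) \<le> card ?S" .
    then have "real (card (W \<inter> {z<..<L})) * r\<^sup>2 + r\<^sup>2 \<le> real (card ?S) * r\<^sup>2"
      using mult_right_mono[of "real (Suc (card (W \<inter> {z<..<L})))" "real (card ?S)" "r\<^sup>2"]
      by (simp add: algebra_simps)
    moreover have "half_excess r (flux L f z) - real (card (W \<inter> {z<..<L})) * r\<^sup>2 \<le> flux_excess r L f z"
      by (rule less.hyps) (use c z less.prems in auto)
    moreover note flux_excess_step_bound(1)[OF f _ _ sgn, of L r]
    ultimately show ?thesis using z less.prems by auto
  qed
qed

text \<open>
  If the flux at the vertex is negative and \<open>f \<ge> 0\<close> next to the vertex, then \<open>\<bar>F\<bar>\<close> grows when one
  moves away from the vertex, up to the first sign change. The extremum \<open>a\<close> reached there satisfies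
  \<open>\<bar>a\<bar> \<ge> \<bar>F 0\<bar>\<close>, and the excess is at least
  \<open>2 * half_excess r a - half_excess r (F 0)\<close> minus \<open>r\<^sup>2\<close> for each of the other sign changes. This
  compensates the loss of \<open>r\<^sup>2\<close> caused by the vertex not being a sign change itself.
\<close>

lemma flux_excess_lower_inward:
  assumes f: "f \<in> borel_measurable borel" "\<And>x. \<bar>f x\<bar> \<le> K"
    and W: "finite W" "W \<subseteq> {0<..<L}" "sign_changes_in W L f" and L: "0 < L"
    and pos: "\<And>x. x \<in> {0<..<L} \<Longrightarrow> {0<..x} \<inter> W = {} \<Longrightarrow> f x \<ge> 0"
    and neg: "flux L f 0 < 0" and r: "0 \<le> r"
  shows "- half_excess r (flux L f 0) - real (card W) * r\<^sup>2 \<le> flux_excess r L f 0"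
    and "flux L f 0 \<le> - r \<Longrightarrow>
      half_excess r (flux L f 0) + r\<^sup>2 - real (card W) * r\<^sup>2 \<le> flux_excess r L f 0"
proof -
  let ?v = "flux L f 0"
  have ne: "W \<noteq> {}"
  proof
    assume "W = {}"
    then have "flux L f L \<le> ?v"
      using flux_excess_step(1)[OF f, of 0 L L] pos L by auto
    then show False using neg by simp
  qed
  define z where "z = Min W"
  have z: "z \<in> W" unfolding z_def by (rule Min_in[OF W(1) ne])
  have zl: "x \<notin> W" if "x < z" for x using Min_le[OF W(1), of x] that unfolding z_def by auto
  have z0: "0 < z" "z < L" using z W(2) by auto
  have p: "f x \<ge> 0" if "x \<in> {0<..<z}" for x
    using that z0 zl by (intro pos) force+
  note st = flux_excess_step[OF f _ _ p]
  define a where "a = flux L f z"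
  have av: "a \<le> ?v" unfolding a_def using st(1) z0 by simp
  have sub: "insert z (W \<inter> {z<..<L}) \<subseteq> W" using z by auto
  have "Suc (card (W \<inter> {z<..<L})) = card (insert z (W \<inter> {z<..<L}))" using W(1) by simp
  also have "\<dots> \<le> card W" by (rule card_mono[OF W(1) sub])
  finally have "real (card (W \<inter> {z<..<L})) * r\<^sup>2 + r\<^sup>2 \<le> real (card W) * r\<^sup>2"
    using mult_right_mono[of "real (Suc (card (W \<inter> {z<..<L})))" "real (card W)" "r\<^sup>2"]
    by (simp add: algebra_simps)
  moreover have "half_excess r a - real (card (W \<inter> {z<..<L})) * r\<^sup>2 \<le> flux_excess r L f z"
    unfolding a_def by (rule flux_excess_lower[OF f W(1,3)]) (use z0 in auto)
  moreover have "flux_excess r L f 0 = flux_excess r L f z + (?v * \<bar>?v\<bar> / 2 - a * \<bar>a\<bar> / 2 - r * (?v - a))"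
    unfolding a_def using st(2) z0 by simp
  moreover have "(?v * \<bar>?v\<bar> / 2 - a * \<bar>a\<bar> / 2 - r * (?v - a)) = half_excess r a - half_excess r ?v"
    using neg av by (simp add: half_excess_def power2_eq_square algebra_simps)
  ultimately have main: "2 * half_excess r a - half_excess r ?v + r\<^sup>2 - real (card W) * r\<^sup>2 \<le> flux_excess r L f 0"
    by linarith
  have "0 \<le> (\<bar>a\<bar> - r)\<^sup>2" by simp
  then have "- r\<^sup>2 \<le> 2 * half_excess r a" by (simp add: half_excess_def power2_eq_square algebra_simps)
  then show "- half_excess r ?v - real (card W) * r\<^sup>2 \<le> flux_excess r L f 0"
    using main by linarith
  assume vr: "?v \<le> - r"
  have "(?v + r)\<^sup>2 \<le> (a + r)\<^sup>2" using av vr by (simp add: abs_le_square_iff[symmetric])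
  then have "half_excess r ?v \<le> half_excess r a"
    using neg av by (simp add: half_excess_def power2_eq_square algebra_simps)
  then show "half_excess r ?v + r\<^sup>2 - real (card W) * r\<^sup>2 \<le> flux_excess r L f 0"
    using main by linarith
qed

section \<open>Balance at the vertex\<close>

text \<open>
  This is \<open>2 * p * m / D\<close> for the most balanced partition \<open>p + m = D\<close> of the edges. The
  parity enters because the mass arriving at the vertex is distributed over a whole number of edges.
\<close>

definition vertex_weight :: "nat \<Rightarrow> real"
  where "vertex_weight D =
    (if even D then real D / 2 else (real D + 1) * (real D - 1) / (2 * real D))"

lemma vertex_weight_lower:
  assumes "D \<ge> 1"
  shows "real D / 2 - 1 / (2 * real D) \<le> vertex_weight D"
  using assms by (auto simp: vertex_weight_def field_simps)

lemma vertex_weight_ge_1: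
  assumes "D \<ge> 2"
  shows "1 \<le> vertex_weight D"
proof (cases "D = 2")
  case True
  then show ?thesis by (simp add: vertex_weight_def)
next
  case False
  with assms have D: "real D \<ge> 3" by simp
  then have "1 / (2 * real D) \<le> 1 / 2" by simp
  with D vertex_weight_lower[of D] assms show ?thesis by linarith
qed

lemma half_excess_tangent: "(c - r) * \<bar>v\<bar> - c\<^sup>2 / 2 \<le> half_excess r v"
proof -
  have "0 \<le> (\<bar>v\<bar> - c)\<^sup>2" by simp
  then show ?thesis by (simp add: half_excess_def power2_eq_square algebra_simps)
qed

lemma sum_split_sign:
  fixes v :: "'a \<Rightarrow> real"
  assumes I: "finite I" and v0: "(\<Sum>j\<in>I. v j) = 0"
  obtains P N B where "P \<union> N = I" "\<And>j. j \<in> P \<Longrightarrow> 0 \<le> v j" "\<And>j. j \<in> N \<Longrightarrow> v j < 0"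
    "(\<Sum>j\<in>P. \<bar>v j\<bar>) = B" "(\<Sum>j\<in>N. \<bar>v j\<bar>) = B"
    "\<And>g :: 'a \<Rightarrow> real. sum g I = sum g P + sum g N" "card I = card P + card N"
proof -
  define P N where "P = {j\<in>I. 0 \<le> v j}" and "N = {j\<in>I. v j < 0}"
  have I_eq: "I = P \<union> N" and disj: "P \<inter> N = {}" and fin: "finite P" "finite N"
    using I by (auto simp: P_def N_def)
  have split: "sum g I = sum g P + sum g N" for g :: "'a \<Rightarrow> real"
    by (subst I_eq, rule sum.union_disjoint) (use disj fin in auto)
  have "card I = card P + card N"
    by (subst I_eq, rule card_Un_disjoint) (use disj fin in auto)
  moreover have "(\<Sum>j\<in>N. \<bar>v j\<bar>) = sum v P"
  proof -
    have "(\<Sum>j\<in>N. \<bar>v j\<bar>) = (\<Sum>j\<in>N. - v j)" by (rule sum.cong) (auto simp: N_def)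
    then show ?thesis using split[of v] v0 by (simp add: sum_negf)
  qed
  moreover have "(\<Sum>j\<in>P. \<bar>v j\<bar>) = sum v P" by (rule sum.cong) (auto simp: P_def)
  ultimately show ?thesis
    by (intro that[of P N "sum v P"] split I_eq[symmetric]) (auto simp: P_def N_def)
qed

text \<open>
  For even \<open>D\<close> every summand is at least \<open>- r\<^sup>2 / 2\<close>. For odd \<open>D\<close> the values \<open>v j\<close> cannot all be
  \<open>\<plusminus> r\<close>, because they sum to zero; if \<open>p\<close> of them are nonnegative and \<open>m\<close> are negative, the minimum
  is attained when they equal \<open>2 * r * m / D\<close> and \<open>- 2 * r * p / D\<close>, and its value is
  \<open>- 2 * r\<^sup>2 * p * m / D\<close>. The proof bounds \<open>half_excess\<close> by its tangents at these points.
\<close>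

lemma sum_half_excess_lower:
  fixes v :: "'a \<Rightarrow> real"
  assumes I: "finite I" "card I = D" "D \<ge> 1" and v0: "(\<Sum>j\<in>I. v j) = 0"
  shows "- vertex_weight D * r\<^sup>2 \<le> (\<Sum>j\<in>I. half_excess r (v j))"
proof (cases "even D")
  case True
  have "- (r\<^sup>2 / 2) \<le> half_excess r (v j)" for j
    using half_excess_tangent[of r r "v j"] by simp
  then have "(\<Sum>j\<in>I. - (r\<^sup>2 / 2)) \<le> (\<Sum>j\<in>I. half_excess r (v j))" by (intro sum_mono)
  then show ?thesis using True I by (simp add: vertex_weight_def)
next
  case False
  obtain P N B where PN: "P \<union> N = I" "\<And>j. j \<in> P \<Longrightarrow> 0 \<le> v j" "\<And>j. j \<in> N \<Longrightarrow> v j < 0"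
    and B: "(\<Sum>j\<in>P. \<bar>v j\<bar>) = B" "(\<Sum>j\<in>N. \<bar>v j\<bar>) = B"
    and split: "\<And>g :: 'a \<Rightarrow> real. sum g I = sum g P + sum g N"
    and cI: "card I = card P + card N"
    by (rule sum_split_sign[OF I(1) v0]) (rule that)
  define p m where "p = real (card P)" and "m = real (card N)"
  have D: "real D = p + m" using cI I(2) by (simp add: p_def m_def)
  have D0: "real D > 0" using I(3) by simp
  \<comment> \<open>The minimisers of the two kinds of summands; they add up to \<open>2 * r\<close>, so that \<open>B\<close> cancels.\<close>
  define x y where "x = 2 * r * m / real D" and "y = 2 * r * p / real D"
  have xy: "x + y = 2 * r" using D0 unfolding x_def y_def add_divide_distrib[symmetric]
    by (simp add: D field_simps)
  have "(\<Sum>j\<in>P. (x - r) * \<bar>v j\<bar> - x\<^sup>2 / 2) \<le> (\<Sum>j\<in>P. half_excess r (v j))"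
    by (intro sum_mono half_excess_tangent)
  then have 1: "(x - r) * B - p * (x\<^sup>2 / 2) \<le> (\<Sum>j\<in>P. half_excess r (v j))"
    by (simp add: sum_subtractf sum_distrib_left[symmetric] B p_def)
  have "(\<Sum>j\<in>N. (y - r) * \<bar>v j\<bar> - y\<^sup>2 / 2) \<le> (\<Sum>j\<in>N. half_excess r (v j))"
    by (intro sum_mono half_excess_tangent)
  then have 2: "(y - r) * B - m * (y\<^sup>2 / 2) \<le> (\<Sum>j\<in>N. half_excess r (v j))"
    by (simp add: sum_subtractf sum_distrib_left[symmetric] B m_def)
  have "(x - r) * B + (y - r) * B = (x + y - 2 * r) * B" by (simp add: algebra_simps)
  then have 3: "- (p * (x\<^sup>2 / 2) + m * (y\<^sup>2 / 2)) \<le> (\<Sum>j\<in>I. half_excess r (v j))"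
    using 1 2 xy by (simp add: split)
  have "p * (x\<^sup>2 / 2) + m * (y\<^sup>2 / 2) = 2 * r\<^sup>2 * (p * m) * (p + m) / (real D)\<^sup>2"
    using D0 by (simp add: x_def y_def power_divide power_mult_distrib field_simps power2_eq_square)
  also have "\<dots> = 2 * r\<^sup>2 * (p * m) / real D"
    unfolding D[symmetric] using D0 by (simp add: power2_eq_square)
  also have "\<dots> \<le> vertex_weight D * r\<^sup>2"
  proof -
    \<comment> \<open>As \<open>D\<close> is odd, \<open>4 * p * m = D\<^sup>2 - (p - m)\<^sup>2 \<le> D\<^sup>2 - 1\<close>.\<close>
    have "card P \<noteq> card N" using False cI I(2) by auto
    then have "1 \<le> \<bar>p - m\<bar>" unfolding p_def m_def by linarith
    then have "1 \<le> (p - m)\<^sup>2" using abs_le_square_iff[of 1 "p - m"] by simp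
    then have "4 * (p * m) \<le> (real D + 1) * (real D - 1)"
      unfolding D by (simp add: power2_eq_square algebra_simps)
    then have "r\<^sup>2 * (4 * (p * m)) \<le> r\<^sup>2 * ((real D + 1) * (real D - 1))"
      by (rule mult_left_mono) simp
    then show ?thesis using D0 False by (simp add: vertex_weight_def field_simps)
  qed
  finally show ?thesis using 3 by simp
qed

text \<open>
  The situation where the vertex is not a sign change: one has to gain \<open>r\<^sup>2\<close> over the preceding bound.
  If some \<open>v j \<le> - r\<close>, that edge alone provides the gain. If no \<open>v j\<close> is negative, all of them vanish
  and so do the losses at the vertex. Otherwise the negative \<open>v j\<close> lie in \<open>(- r, 0)\<close>, where
  \<open>- half_excess r v \<ge> r * \<bar>v\<bar> / 2\<close>; this cancels the linear part of the tangents at \<open>r / 2\<close> that are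
  used for the nonnegative ones, so that only \<open>r\<^sup>2 / 8\<close> is lost for each of these. For two edges this
  is too weak, but there the two fluxes are opposite and the two bounds cancel exactly.
\<close>

lemma sum_excess_lower_inward:
  fixes v e :: "'a \<Rightarrow> real"
  assumes I: "finite I" "card I = D" "D \<ge> 2" and v0: "(\<Sum>j\<in>I. v j) = 0" and r: "r > 0"
    and e: "\<And>j. j \<in> I \<Longrightarrow> half_excess r (v j) \<le> e j"
    and e_neg: "\<And>j. j \<in> I \<Longrightarrow> v j < 0 \<Longrightarrow> - half_excess r (v j) \<le> e j"
    and e_low: "\<And>j. j \<in> I \<Longrightarrow> v j \<le> - r \<Longrightarrow> half_excess r (v j) + r\<^sup>2 \<le> e j"
  shows "- (vertex_weight D - 1) * r\<^sup>2 \<le> (\<Sum>j\<in>I. e j)"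
proof -
  obtain P N B where PN: "P \<union> N = I" "\<And>j. j \<in> P \<Longrightarrow> 0 \<le> v j" "\<And>j. j \<in> N \<Longrightarrow> v j < 0"
    and B: "(\<Sum>j\<in>P. \<bar>v j\<bar>) = B" "(\<Sum>j\<in>N. \<bar>v j\<bar>) = B"
    and split: "\<And>g :: 'a \<Rightarrow> real. sum g I = sum g P + sum g N"
    and cI: "card I = card P + card N"
    by (rule sum_split_sign[OF I(1) v0]) (rule that)
  have r2: "r\<^sup>2 > 0" using r by simp
  consider (low) k where "k \<in> I" "v k \<le> - r"
    | (zero) "N = {}" | (two) "D = 2" "N \<noteq> {}"
    | (small) "D \<ge> 3" "N \<noteq> {}" "\<And>j. j \<in> I \<Longrightarrow> - r < v j"
    using I(3) by force
  then show ?thesis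
  proof cases
    case low
    have "(\<Sum>j\<in>I. half_excess r (v j)) + r\<^sup>2 =
        (half_excess r (v k) + r\<^sup>2) + (\<Sum>j\<in>I - {k}. half_excess r (v j))"
      using sum.remove[OF I(1) low(1), of "\<lambda>j. half_excess r (v j)"] by simp
    also have "\<dots> \<le> e k + (\<Sum>j\<in>I - {k}. e j)"
      using e e_low low by (intro add_mono sum_mono) auto
    also have "\<dots> = (\<Sum>j\<in>I. e j)" by (rule sum.remove[OF I(1) low(1), symmetric])
    finally show ?thesis
      using sum_half_excess_lower[OF I(1,2) _ v0, of r] I(3) by (simp add: algebra_simps)
  next
    case zero
    then have B0: "(\<Sum>j\<in>P. \<bar>v j\<bar>) = 0" using B by (metis sum.empty)
    have "v j = 0" if "j \<in> I" for j
    proof -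
      have "j \<in> P" "finite P" using zero that PN(1) I(1) by auto
      then show ?thesis using B0 sum_nonneg_eq_0_iff[of P "\<lambda>j. \<bar>v j\<bar>"] by simp
    qed
    then have "0 \<le> e j" if "j \<in> I" for j using e[OF that] that by (simp add: half_excess_def)
    then have "0 \<le> (\<Sum>j\<in>I. e j)" by (rule sum_nonneg)
    moreover have "0 \<le> (vertex_weight D - 1) * r\<^sup>2" using vertex_weight_ge_1[OF I(3)] by simp
    ultimately show ?thesis by (simp only: mult_minus_left)
  next
    case two
    obtain a b where ab: "I = {a, b}" "a \<noteq> b" using I(2) two by (metis card_2_iff)
    then have s: "v a + v b = 0" using v0 by simp
    have "0 \<le> e a + e b"
    proof (cases "v a < 0")
      case True
      have "half_excess r (v b) = half_excess r (v a)" using s half_excess_uminus[of r "v b"]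
        by (metis add_eq_0_iff2)
      then show ?thesis using e[of b] e_neg[of a] ab True by simp
    next
      case False
      have ha: "half_excess r (v b) = half_excess r (v a)" using s half_excess_uminus[of r "v b"]
        by (metis add_eq_0_iff2)
      obtain x where "x \<in> N" using two(2) by blast
      then have "v x < 0" "x \<in> {a, b}" using PN(1,3) ab(1) by auto
      then have "v b < 0" using False by auto
      then show ?thesis using e[of a] e_neg[of b] ab ha by simp
    qed
    then show ?thesis using two ab by (simp add: vertex_weight_def)
  next
    case small
    have "(\<Sum>j\<in>P. (r / 2 - r) * \<bar>v j\<bar> - (r / 2)\<^sup>2 / 2) \<le> (\<Sum>j\<in>P. e j)"
      by (rule sum_mono, rule order_trans[OF half_excess_tangent e]) (use PN(1) in auto)
    then have 1: "- (r / 2) * B - real (card P) * (r\<^sup>2 / 8) \<le> (\<Sum>j\<in>P. e j)"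
      by (simp only: sum_subtractf sum_distrib_left[symmetric] B sum_constant) (simp add: power_divide)
    have "(\<Sum>j\<in>N. (r / 2) * \<bar>v j\<bar>) \<le> (\<Sum>j\<in>N. e j)"
    proof (rule sum_mono)
      fix j assume j: "j \<in> N"
      then have "j \<in> I" "v j < 0" using PN(1,3) by auto
      then have "\<bar>v j\<bar> * \<bar>v j\<bar> \<le> r * \<bar>v j\<bar>" using small(3)[of j] by (intro mult_right_mono) auto
      then have "(r / 2) * \<bar>v j\<bar> \<le> - half_excess r (v j)"
        by (simp add: half_excess_def power2_eq_square)
      also have "\<dots> \<le> e j" using e_neg \<open>j \<in> I\<close> \<open>v j < 0\<close> by auto
      finally show "(r / 2) * \<bar>v j\<bar> \<le> e j" .
    qed
    then have 2: "(r / 2) * B \<le> (\<Sum>j\<in>N. e j)"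
      by (simp only: sum_distrib_left[symmetric] B)
    have "card N \<ge> 1" using small(2) finite_subset[of N I] PN(1) I(1) by (auto simp: card_gt_0_iff Suc_le_eq)
    then have "real (card P) \<le> real D - 1" using cI I(2) by linarith
    moreover have "1 / (2 * real D) \<le> 1 / 6" using small(1) by (simp add: field_simps)
    moreover have "real D \<ge> 3" using small(1) by simp
    ultimately have "real (card P) / 8 \<le> vertex_weight D - 1"
      using vertex_weight_lower[of D] I(3) by linarith
    then have "real (card P) / 8 * r\<^sup>2 \<le> (vertex_weight D - 1) * r\<^sup>2"
      by (rule mult_right_mono) simp
    then show ?thesis using 1 2 unfolding split[of e] by (simp only: mult_minus_left)
  qed
qed

lemma sum_flux_excess_lower:
  fixes g :: "'a \<Rightarrow> real \<Rightarrow> real" and L :: "'a \<Rightarrow> real"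
  assumes I: "finite I" "card I = D" "D \<ge> 2" and r: "r > 0"
    and g: "\<And>j. j \<in> I \<Longrightarrow> g j \<in> borel_measurable borel" "\<And>j x. j \<in> I \<Longrightarrow> \<bar>g j x\<bar> \<le> K"
    and L: "\<And>j. j \<in> I \<Longrightarrow> L j > 0"
    and W: "\<And>j. j \<in> I \<Longrightarrow> finite (W j)" "\<And>j. j \<in> I \<Longrightarrow> W j \<subseteq> {0<..<L j}"
      "\<And>j. j \<in> I \<Longrightarrow> sign_changes_in (W j) (L j) (g j)"
    and g0: "(\<Sum>j\<in>I. flux (L j) (g j) 0) = 0"
  shows "- (vertex_weight D + (\<Sum>j\<in>I. real (card (W j)))) * r\<^sup>2 \<le> (\<Sum>j\<in>I. flux_excess r (L j) (g j) 0)"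
    and "(\<And>j x. j \<in> I \<Longrightarrow> x \<in> {0<..<L j} \<Longrightarrow> {0<..x} \<inter> W j = {} \<Longrightarrow> g j x \<ge> 0) \<Longrightarrow>
      - (vertex_weight D - 1 + (\<Sum>j\<in>I. real (card (W j)))) * r\<^sup>2 \<le> (\<Sum>j\<in>I. flux_excess r (L j) (g j) 0)"
proof -
  define v where "v j = flux (L j) (g j) 0" for j
  define e where "e j = flux_excess r (L j) (g j) 0 + real (card (W j)) * r\<^sup>2" for j
  have sum_e: "(\<Sum>j\<in>I. e j) = (\<Sum>j\<in>I. flux_excess r (L j) (g j) 0) + (\<Sum>j\<in>I. real (card (W j))) * r\<^sup>2"
    by (simp add: e_def sum.distrib sum_distrib_right)
  have v0: "(\<Sum>j\<in>I. v j) = 0" using g0 by (simp add: v_def)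
  have e_half: "half_excess r (v j) \<le> e j" if j: "j \<in> I" for j
    using flux_excess_lower[OF g[OF j] W(1,3)[OF j], of 0 r] L[OF j] W(2)[OF j]
    by (simp add: v_def e_def Int_absorb2)
  have "- vertex_weight D * r\<^sup>2 \<le> (\<Sum>j\<in>I. half_excess r (v j))"
    using sum_half_excess_lower[OF I(1,2) _ v0] I(3) by simp
  also have "\<dots> \<le> (\<Sum>j\<in>I. e j)" by (intro sum_mono e_half)
  finally show "- (vertex_weight D + (\<Sum>j\<in>I. real (card (W j)))) * r\<^sup>2 \<le> (\<Sum>j\<in>I. flux_excess r (L j) (g j) 0)"
    by (simp add: sum_e algebra_simps)
  assume pos: "\<And>j x. j \<in> I \<Longrightarrow> x \<in> {0<..<L j} \<Longrightarrow> {0<..x} \<inter> W j = {} \<Longrightarrow> g j x \<ge> 0"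
  have in1: "- half_excess r (v j) \<le> e j" if j: "j \<in> I" and "v j < 0" for j
    using flux_excess_lower_inward(1)[OF g[OF j] W[OF j] L[OF j] pos[OF j], of r] that r
    by (simp add: v_def e_def)
  have in2: "half_excess r (v j) + r\<^sup>2 \<le> e j" if j: "j \<in> I" and vj: "v j \<le> - r" for j
    using flux_excess_lower_inward(2)[OF g[OF j] W[OF j] L[OF j] pos[OF j], of r] vj r
    by (simp add: v_def e_def)
  have "- (vertex_weight D - 1) * r\<^sup>2 \<le> (\<Sum>j\<in>I. e j)"
    by (rule sum_excess_lower_inward[OF I v0 r e_half in1 in2])
  then show "- (vertex_weight D - 1 + (\<Sum>j\<in>I. real (card (W j)))) * r\<^sup>2 \<le> (\<Sum>j\<in>I. flux_excess r (L j) (g j) 0)"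
    by (simp add: sum_e algebra_simps)
qed

section \<open>Sets separating the signs\<close>

text \<open>
  The union of two edges, parametrised isometrically by an interval with the vertex at \<open>0\<close>.
\<close>

definition star_line :: "nat \<Rightarrow> nat \<Rightarrow> real \<Rightarrow> nat \<times> real"
  where "star_line k l s = (if 0 \<le> s then star_point k s else star_point l (- s))"

text \<open>
  All edges but the \<open>k\<close>-th are folded onto the negative half-line. This map is 1-Lipschitz and injective
  over the \<open>k\<close>-th edge, so it turns connectedness in the star into the intermediate value property.
\<close>

definition star_fold :: "nat \<Rightarrow> nat \<times> real \<Rightarrow> real"
  where "star_fold k p = (if fst p = k then snd p else - snd p)"

lemma star_line_swap: "star_line l k (- s) = star_line k l s"
  by (auto simp: star_line_def star_point_def)

lemma star_point_0 [simp]: "star_point j 0 = (0, 0)"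
  by (simp add: star_point_def)

lemma star_line_0 [simp]: "star_line k l 0 = (0, 0)"
  by (simp add: star_line_def)

lemma star_line_nonneg: "0 \<le> s \<Longrightarrow> star_line k l s = star_point k s"
  by (simp add: star_line_def)

lemma star_point_in_star: "j \<in> {1..D} \<Longrightarrow> 0 \<le> x \<Longrightarrow> x < L j \<Longrightarrow> star_point j x \<in> star D L"
  by (force simp: star_def star_edges_def)

lemma star_line_in_star:
  "k \<in> {1..D} \<Longrightarrow> l \<in> {1..D} \<Longrightarrow> s \<in> {- L l<..<L k} \<Longrightarrow> star_line k l s \<in> star D L"
  by (auto simp: star_line_def intro!: star_point_in_star)

lemma star_dist_star_line: "k \<noteq> l \<Longrightarrow> star_dist (star_line k l s) (star_line k l t) = \<bar>s - t\<bar>"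
  by (auto simp: star_line_def star_dist_star_point)

lemma star_elem:
  assumes "u \<in> star D L"
  shows "0 \<le> snd u" "snd u = 0 \<Longrightarrow> u = (0, 0)"
  using assms by (auto simp: star_def star_edges_def star_point_def split: if_splits)

lemma star_fold_star_point: "0 < k \<Longrightarrow> star_fold k (star_point k s) = s"
  by (auto simp: star_fold_def star_point_def)

lemma continuous_map_star_line:
  assumes "k \<in> {1..D}" "l \<in> {1..D}" "k \<noteq> l"
  shows "continuous_map (top_of_set {- L l<..<L k}) (star_topology D L) (star_line k l)"
proof -
  interpret Metric_space "star D L" star_dist by (rule Metric_space_star)
  show ?thesis
    unfolding star_topology_def continuous_map_to_metric
  proof (intro ballI allI impI)
    fix x \<epsilon> :: real assume x: "x \<in> topspace (top_of_set {- L l<..<L k})" and \<epsilon>: "\<epsilon> > 0"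
    show "\<exists>U. openin (top_of_set {- L l<..<L k}) U \<and> x \<in> U \<and> (\<forall>y\<in>U. star_line k l y \<in> mball (star_line k l x) \<epsilon>)"
      using x \<epsilon> assms
      by (intro exI[of _ "{- L l<..<L k} \<inter> ball x \<epsilon>"])
         (auto simp: star_dist_star_line star_line_in_star dist_real_def)
  qed
qed

lemma continuous_map_star_fold: "continuous_map (star_topology D L) euclideanreal (star_fold k)"
proof -
  interpret Metric_space "star D L" star_dist by (rule Metric_space_star)
  have d: "dist (star_fold k p) (star_fold k q) \<le> star_dist p q" if "p \<in> star D L" "q \<in> star D L" for p q
    using star_elem(1)[OF that(1)] star_elem(1)[OF that(2)]
    by (auto simp: star_fold_def star_dist_def dist_real_def)
  show ?thesis
    unfolding star_topology_def continuous_map_from_metric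
  proof (intro conjI ballI allI impI)
    fix a U assume a: "a \<in> star D L" and U: "openin euclideanreal U \<and> star_fold k a \<in> U"
    then obtain e where "e > 0" "ball (star_fold k a) e \<subseteq> U"
      by (auto simp: open_contains_ball)
    then show "\<exists>r>0. \<forall>x. x \<in> star D L \<and> star_dist a x < r \<longrightarrow> star_fold k x \<in> U"
      using d[OF a] by (intro exI[of _ e]) (force simp: subset_iff)
  qed auto
qed

text \<open>
  Connected sets are convex along edges: over \<open>t \<ge> 0\<close> the folding map has a single preimage.
\<close>

lemma connectedin_star_edge:
  assumes J: "connectedin (star_topology D L) J" and k: "0 < k" and t: "0 \<le> t"
    and p: "p \<in> J" "star_fold k p \<le> t" and q: "q \<in> J" "t \<le> star_fold k q"
  shows "star_point k t \<in> J"
proof -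
  have "connected (star_fold k ` J)"
    using connectedin_continuous_map_image[OF continuous_map_star_fold J] by simp
  then have "t \<in> star_fold k ` J" using p q unfolding connected_iff_interval by blast
  then obtain u where u: "u \<in> J" "t = star_fold k u" by blast
  have "u \<in> star D L" using u J connectedin_subset_topspace by fastforce
  note s = star_elem[OF this]
  have "u = star_point k t"
    using u(2) s t by (cases u) (auto simp: star_fold_def star_point_def split: if_splits)
  then show ?thesis using u by simp
qed

lemma frontier_ofI:
  assumes "p \<in> X closure_of A" "p \<in> X closure_of B" "A \<inter> B = {}"
  shows "p \<in> X frontier_of A"
proof -
  have "X interior_of A \<inter> B = {}" using interior_of_subset[of X A] assms(3) by blast
  then have "X interior_of A \<inter> X closure_of B = {}"
    by (simp add: openin_Int_closure_of_eq_empty)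
  then show ?thesis using assms(1,2) by (auto simp: frontier_of_def)
qed

text \<open>
  Go from \<open>a\<close> to the last point \<open>s\<close> that is a limit of points where \<open>f > 0\<close>, and then on to the first
  limit \<open>t0\<close> of points where \<open>f < 0\<close>. If \<open>s = t0\<close>, this is a nodal point. Otherwise \<open>f\<close> vanishes on
  the interval between them, which therefore lies in a nodal component whose closure contains both ends.
\<close>

lemma nodal_crossing:
  assumes kl: "k \<in> {1..D}" "l \<in> {1..D}" "k \<noteq> l" and ab: "- L l < a" "a \<le> b" "b < L k"
    and f: "f (star_line k l a) > 0" "f (star_line k l b) < 0"
  defines "X \<equiv> star_topology D L"
  shows "\<exists>s\<in>{a..b}. star_line k l s \<in> nodal_points X f \<or>
    (\<exists>J\<in>nodal_components X f. star_line k l s \<in> J)"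
proof -
  let ?\<rho> = "star_line k l" and ?I = "{- L l<..<L k}"
  define S where "S = {t \<in> {a..b}. f (?\<rho> t) > 0}"
  have S: "a \<in> S" "bdd_above S" using f ab by (auto simp: S_def)
  define s where "s = Sup S"
  have s: "a \<le> s" "s \<le> b" unfolding s_def using S
    by (auto simp: S_def intro!: cSup_upper cSup_least)
  have sle: "f (?\<rho> t) \<le> 0" if "s < t" "t \<le> b" for t
  proof (rule ccontr)
    assume "\<not> f (?\<rho> t) \<le> 0"
    then have "t \<in> S" using that s by (simp add: S_def)
    then have "t \<le> s" unfolding s_def by (rule cSup_upper[OF _ S(2)])
    then show False using that by simp
  qed
  define T where "T = {t \<in> {s..b}. f (?\<rho> t) < 0}"
  have T: "b \<in> T" "bdd_below T" using f s by (auto simp: T_def)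
  define t0 where "t0 = Inf T"
  have t0: "s \<le> t0" "t0 \<le> b" unfolding t0_def using T
    by (auto simp: T_def intro!: cInf_lower cInf_greatest)
  have tge: "f (?\<rho> t) \<ge> 0" if "s \<le> t" "t < t0" for t
  proof (rule ccontr)
    assume "\<not> f (?\<rho> t) \<ge> 0"
    then have "t \<in> T" using that t0 by (simp add: T_def)
    then have "t0 \<le> t" unfolding t0_def by (rule cInf_lower[OF _ T(2)])
    then show False using that by simp
  qed
  have cl: "?\<rho> x \<in> X closure_of Q"
    if x: "x \<in> ?I" "x \<in> closure A" "A \<subseteq> ?I" "?\<rho> ` A \<subseteq> Q" for x A Q
  proof -
    have "x \<in> (top_of_set ?I) closure_of A"
      using x by (auto simp: closure_of_subtopology Int_absorb2 Int_absorb1)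
    then have "?\<rho> x \<in> X closure_of (?\<rho> ` A)"
      using continuous_map_image_closure_subset[OF continuous_map_star_line[OF kl]]
      unfolding X_def by blast
    then show ?thesis using closure_of_mono[OF x(4)] by blast
  qed
  have inI: "x \<in> ?I" if "x \<in> {a..b}" for x using that ab by auto
  have star: "?\<rho> x \<in> topspace X" if "x \<in> ?I" for x
    using star_line_in_star[OF kl(1,2) that] by (simp add: X_def)
  have "s \<in> closure S" unfolding s_def by (rule closure_contains_Sup) (use S in auto)
  then have ps: "?\<rho> s \<in> X closure_of pos_set X f"
    by (rule cl[rotated]) (use s inI star in \<open>auto simp: S_def pos_set_def\<close>)
  have "t0 \<in> closure T" unfolding t0_def by (rule closure_contains_Inf) (use T in auto)
  then have nt: "?\<rho> t0 \<in> X closure_of neg_set X f"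
    by (rule cl[rotated]) (use s t0 inI star in \<open>auto simp: T_def neg_set_def\<close>)
  show ?thesis
  proof (cases "s = t0")
    case True
    then have "?\<rho> s \<in> nodal_points X f"
      unfolding nodal_points_def
      using frontier_ofI[OF ps, of "neg_set X f"] frontier_ofI[OF nt, of "pos_set X f"] ps nt
      by (auto simp: pos_set_def neg_set_def disjoint_iff)
    then show ?thesis using s by auto
  next
    case False
    then have lt: "s < t0" using t0 by simp
    let ?C = "?\<rho> ` {s<..<t0}"
    have sub: "{s<..<t0} \<subseteq> ?I" using s t0 ab by auto
    have C0: "?C \<subseteq> zero_set X f"
    proof
      fix p assume "p \<in> ?C"
      then obtain t where t: "p = ?\<rho> t" "s < t" "t < t0" by auto
      then show "p \<in> zero_set X f"
        using sle[of t] tge[of t] t0 star[of t] sub by (auto simp: zero_set_def)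
    qed
    have "connectedin (top_of_set ?I) {s<..<t0}"
      using sub by (simp add: connectedin_subtopology)
    from connectedin_continuous_map_image[OF continuous_map_star_line[OF kl] this]
    have "connectedin (subtopology X (zero_set X f)) ?C"
      using C0 by (simp add: X_def connectedin_subtopology)
    moreover have "?C \<noteq> {}" using lt by simp
    moreover have "subtopology X (zero_set X f) \<noteq> trivial_topology"
    proof -
      have "topspace (subtopology X (zero_set X f)) \<noteq> {}"
        using C0 \<open>?C \<noteq> {}\<close> unfolding topspace_subtopology zero_set_def by blast
      then show ?thesis by (simp only: null_topspace_iff_trivial[symmetric] not_False_eq_True)
    qed
    ultimately obtain J where J: "J \<in> connected_components_of (subtopology X (zero_set X f))" "?C \<subseteq> J"
      using exists_connected_component_of_superset by blast
    have Jz: "J \<subseteq> zero_set X f"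
      using connected_components_of_subset[OF J(1)] by simp
    have "closure {s<..<t0} = {s..t0}" using lt by (simp add: closure_greaterThanLessThan)
    then have ends: "?\<rho> s \<in> X closure_of J" "?\<rho> t0 \<in> X closure_of J"
      using lt s t0 by (intro cl[OF inI _ sub J(2)], simp_all)+
    have "?\<rho> s \<in> X frontier_of pos_set X f"
      by (rule frontier_ofI[OF ps ends(1)]) (use Jz in \<open>auto simp: pos_set_def zero_set_def\<close>)
    moreover have "?\<rho> t0 \<in> X frontier_of neg_set X f"
      by (rule frontier_ofI[OF nt ends(2)]) (use Jz in \<open>auto simp: neg_set_def zero_set_def\<close>)
    ultimately have "J \<in> nodal_components X f"
      using J(1) ends unfolding nodal_components_def by auto
    moreover have "?\<rho> ((s + t0) / 2) \<in> J" using J(2) lt by auto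
    ultimately show ?thesis using lt s t0 by (intro bexI[of _ "(s + t0) / 2"]) auto
  qed
qed

text \<open>
  A connected set through the vertex can meet a segment while missing its ends only if the segment
  itself passes through the vertex.
\<close>

lemma connectedin_star_line_hub:
  assumes J: "connectedin (star_topology D L) J" and kl: "0 < k" "0 < l"
    and "(0, 0) \<in> J" and s: "s \<in> {a..b}" "star_line k l s \<in> J"
    and ab: "star_line k l a \<notin> J" "star_line k l b \<notin> J"
  shows "0 \<in> {a..b}"
proof -
  have pos: "a \<le> 0"
    if "0 < k" "s \<in> {a..b}" "star_line k l s \<in> J" "star_line k l a \<notin> J" for k l s a b
  proof (rule ccontr)
    assume "\<not> a \<le> 0"
    then have "star_point k a \<in> J"
      using that \<open>(0, 0) \<in> J\<close> by (intro connectedin_star_edge[OF J, of k a "(0, 0)" "star_line k l s"])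
         (auto simp: star_line_nonneg star_fold_star_point, simp add: star_fold_def)
    then show False using that \<open>\<not> a \<le> 0\<close> by (simp add: star_line_nonneg)
  qed
  have "a \<le> 0" by (rule pos[OF kl(1) s ab(1)])
  moreover have "- b \<le> 0"
    by (rule pos[OF kl(2), of "- s" _ "- a" k]) (use s ab in \<open>auto simp: star_line_swap\<close>)
  ultimately show ?thesis by simp
qed

text \<open>
  A connected set that avoids the vertex is an interval in a single edge; if it meets a segment and
  misses its ends, it is trapped inside the segment.
\<close>

lemma connectedin_star_line_offhub:
  assumes J: "connectedin (star_topology D L) J" and kl: "0 < k" "0 < l"
    and 0: "(0, 0) \<notin> J" and s: "s \<in> {a..b}" "star_line k l s \<in> J"
    and ab: "star_line k l a \<notin> J" "star_line k l b \<notin> J" and u: "u \<in> J"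
  shows "\<exists>t\<in>{a..b}. u = star_line k l t"
proof -
  have pos: "\<exists>t\<in>{a..b}. u = star_line k l t"
    if k: "0 < k" and s: "s \<in> {a..b}" "star_line k l s \<in> J" "0 < s"
      and ab: "star_line k l a \<notin> J" "star_line k l b \<notin> J" for k l s a b
  proof -
    note edge = connectedin_star_edge[OF J k]
    have fs: "star_fold k (star_line k l s) = s" using s k by (simp add: star_line_nonneg star_fold_star_point)
    define t where "t = star_fold k u"
    have t0: "0 < t"
    proof (rule ccontr)
      assume "\<not> 0 < t"
      then have "star_point k 0 \<in> J"
        using u s fs by (intro edge[of 0 u "star_line k l s"]) (auto simp: t_def)
      then show False using 0 by simp
    qed
    have "star_point k t \<in> {u}"
    proof -
      have "u \<in> star D L" using u J connectedin_subset_topspace by fastforce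
      from star_elem[OF this] t0 show ?thesis
        by (cases u) (auto simp: t_def star_fold_def star_point_def split: if_splits)
    qed
    moreover have "a \<le> t"
    proof (rule ccontr)
      assume "\<not> a \<le> t"
      then have "star_point k a \<in> J"
        using t0 s u fs by (intro edge[of a u "star_line k l s"]) (auto simp: t_def)
      then show False using ab(1) \<open>\<not> a \<le> t\<close> t0 by (simp add: star_line_nonneg)
    qed
    moreover have "t \<le> b"
    proof (rule ccontr)
      assume "\<not> t \<le> b"
      then have "star_point k b \<in> J"
        using t0 s u fs by (intro edge[of b "star_line k l s" u]) (auto simp: t_def)
      then show False using ab(2) s by (simp add: star_line_nonneg)
    qed
    ultimately show ?thesis using t0 by (auto simp: star_line_nonneg intro!: bexI[of _ t])
  qed
  have "s \<noteq> 0" using 0 s by auto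
  then consider "0 < s" | "0 < - s" by linarith
  then show ?thesis
  proof cases
    case 1
    then show ?thesis using pos[OF kl(1) s] ab by blast
  next
    case 2
    have "\<exists>t\<in>{- b..- a}. u = star_line l k t"
      by (rule pos[OF kl(2), of "- s"]) (use 2 s ab in \<open>auto simp: star_line_swap\<close>)
    then obtain t where "t \<in> {- b..- a}" "u = star_line l k t" by blast
    then show ?thesis using star_line_swap[of l k "- t"] by (intro bexI[of _ "- t"]) auto
  qed
qed

text \<open>
  For \<open>D \<ge> 2\<close> every geodesic of the star lies on a \<open>star_line\<close>, so this says that no geodesic leads from a point
  where \<open>f > 0\<close> to a point where \<open>f < 0\<close> without meeting \<open>W\<close>.
\<close>

definition separates_signs :: "nat \<Rightarrow> (nat \<Rightarrow> real) \<Rightarrow> (nat \<times> real) set \<Rightarrow> (nat \<times> real \<Rightarrow> real) \<Rightarrow> bool"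
  where "separates_signs D L W f \<longleftrightarrow>
    (\<forall>k\<in>{1..D}. \<forall>l\<in>{1..D}. \<forall>a b. k \<noteq> l \<longrightarrow> - L l < a \<longrightarrow> a \<le> b \<longrightarrow> b < L k \<longrightarrow>
      f (star_line k l a) * f (star_line k l b) < 0 \<longrightarrow> (\<exists>s\<in>{a..b}. star_line k l s \<in> W))"

text \<open>
  An effective nodal set need not separate the signs: the point chosen in a nodal component \<open>J\<close> that
  contains the vertex may lie on an edge that a path through \<open>J\<close> never visits. The vertex is the right
  choice for that component, so all points of \<open>Z\<close> in \<open>J\<close> are replaced by the vertex. A nodal point
  of \<open>J\<close> may be dropped here as well, since a path through it meets \<open>J\<close> and hence the vertex. All other
  nodal components are intervals inside one edge, where any choice will do.
\<close>

lemma separating_set_exists: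
  assumes Z: "effective_nodal_set (star_topology D L) f Z" "finite Z"
  obtains W where "finite W" "card W \<le> card Z" "separates_signs D L W f"
proof -
  define X where "X = star_topology D L"
  obtain c where c: "\<And>J. J \<in> nodal_components X f \<Longrightarrow> c J \<in> J"
    and Z_eq: "Z = nodal_points X f \<union> c ` nodal_components X f"
    using Z(1) unfolding effective_nodal_set_def X_def by blast
  have comp: "connectedin X J" "J \<subseteq> zero_set X f" if "J \<in> nodal_components X f" for J
  proof -
    have J: "J \<in> connected_components_of (subtopology X (zero_set X f))"
      using that by (simp add: nodal_components_def)
    show "connectedin X J"
      using connectedin_connected_components_of[OF J] by (simp add: connectedin_subtopology)
    show "J \<subseteq> zero_set X f" using connected_components_of_subset[OF J] by simp
  qed
  have disj: "J \<inter> J' = {}" if "J \<in> nodal_components X f" "J' \<in> nodal_components X f" "J \<noteq> J'" for J J'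
    using pairwise_disjoint_connected_components_of[of "subtopology X (zero_set X f)"] that
    by (auto simp: nodal_components_def pairwise_def disjnt_def)
  define W where "W = (if \<exists>J\<in>nodal_components X f. (0, 0) \<in> J
    then insert (0, 0) (Z - (THE J. J \<in> nodal_components X f \<and> (0, 0) \<in> J)) else Z)"
  have W_hub: "W = insert (0, 0) (Z - J)" if "J \<in> nodal_components X f" "(0, 0) \<in> J" for J
  proof -
    have "(THE J. J \<in> nodal_components X f \<and> (0, 0) \<in> J) = J"
      by (rule the_equality) (use that disj in auto)
    then show ?thesis using that by (auto simp: W_def)
  qed
  have fin: "finite W" using Z(2) by (simp add: W_def)
  have card: "card W \<le> card Z"
  proof (cases "\<exists>J\<in>nodal_components X f. (0, 0) \<in> J")
    case True
    then obtain J where J: "J \<in> nodal_components X f" "(0, 0) \<in> J" by blast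
    have "c J \<in> Z" "c J \<in> J" using J c by (auto simp: Z_eq)
    then have "Z - J \<subset> Z" by auto
    then have "card (Z - J) < card Z" by (rule psubset_card_mono[OF Z(2)])
    then show ?thesis using card_insert_le_m1 W_hub[OF J] Z(2)
      by (metis Suc_leI card_insert_disjoint finite_Diff insert_absorb less_imp_le)
  qed (simp add: W_def)
  have core: "\<exists>s\<in>{a..b}. star_line k l s \<in> W"
    if kl: "k \<in> {1..D}" "l \<in> {1..D}" "k \<noteq> l" and ab: "- L l < a" "a \<le> b" "b < L k"
    and f: "f (star_line k l a) > 0" "f (star_line k l b) < 0" for k l a b
  proof -
    obtain s where s: "s \<in> {a..b}" and
      alt: "star_line k l s \<in> nodal_points X f \<or> (\<exists>J\<in>nodal_components X f. star_line k l s \<in> J)"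
      using nodal_crossing[where f=f, OF kl ab f] unfolding X_def by blast
    have pos: "0 < k" "0 < l" using kl by auto
    have off: "star_line k l a \<notin> J" "star_line k l b \<notin> J" if "J \<in> nodal_components X f" for J
      using comp(2)[OF that] f by (auto simp: zero_set_def)
    have hub: ?thesis if J: "J \<in> nodal_components X f" "(0, 0) \<in> J" "star_line k l s \<in> J" for J
    proof -
      have "0 \<in> {a..b}"
        by (rule connectedin_star_line_hub[OF comp(1)[OF J(1), unfolded X_def] pos J(2) s J(3) off[OF J(1)]])
      then show ?thesis using W_hub[OF J(1,2)] by (intro bexI[of _ 0]) auto
    qed
    show ?thesis
    proof (cases "\<exists>J\<in>nodal_components X f. star_line k l s \<in> J")
      case True
      then obtain J where J: "J \<in> nodal_components X f" "star_line k l s \<in> J" by blast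
      show ?thesis
      proof (cases "(0, 0) \<in> J")
        case True
        then show ?thesis using hub J by blast
      next
        case False
        obtain t where t: "t \<in> {a..b}" "c J = star_line k l t"
          using connectedin_star_line_offhub[OF comp(1)[OF J(1), unfolded X_def] pos False s J(2) off[OF J(1)] c[OF J(1)]]
          by blast
        have nin: "c J \<notin> J'" if "J' \<in> nodal_components X f" "(0, 0) \<in> J'" for J'
          using disj[of J J'] False that J c by blast
        have "c J \<in> W"
        proof (cases "\<exists>J\<in>nodal_components X f. (0, 0) \<in> J")
          case True
          then obtain J' where J': "J' \<in> nodal_components X f" "(0, 0) \<in> J'" by blast
          then have "c J \<in> Z - J'" using nin J(1) unfolding Z_eq by blast
          then show ?thesis unfolding W_hub[OF J'] by blast
        next
          case False
          then have "W = Z" unfolding W_def by simp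
          then show ?thesis using J(1) unfolding Z_eq by blast
        qed
        then show ?thesis using t by auto
      qed
    next
      case False
      then have "star_line k l s \<in> W"
        using alt W_hub by (cases "\<exists>J\<in>nodal_components X f. (0, 0) \<in> J") (auto simp: Z_eq W_def)
      then show ?thesis using s by blast
    qed
  qed
  have "separates_signs D L W f"
    unfolding separates_signs_def
  proof (intro ballI allI impI)
    fix k l a b
    assume h: "k \<in> {1..D}" "l \<in> {1..D}" "k \<noteq> l" "- L l < a" "a \<le> b" "b < L k"
      and "f (star_line k l a) * f (star_line k l b) < 0"
    then consider "f (star_line k l a) > 0" "f (star_line k l b) < 0"
      | "f (star_line k l a) < 0" "f (star_line k l b) > 0"
      by (auto simp: mult_less_0_iff)
    then show "\<exists>s\<in>{a..b}. star_line k l s \<in> W"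
    proof cases
      case 1
      then show ?thesis using core h by blast
    next
      case 2
      have "\<exists>s\<in>{- b..- a}. star_line l k s \<in> W"
        by (rule core) (use h 2 in \<open>auto simp: star_line_swap\<close>)
      then obtain s where "s \<in> {- b..- a}" "star_line l k s \<in> W" by blast
      then show ?thesis using star_line_swap[of l k "- s"] by (intro bexI[of _ "- s"]) auto
    qed
  qed
  then show ?thesis using that fin card by blast
qed

section \<open>Integration over the edges\<close>

definition edge_fun :: "(nat \<Rightarrow> real) \<Rightarrow> (nat \<times> real \<Rightarrow> real) \<Rightarrow> nat \<Rightarrow> real \<Rightarrow> real"
  where "edge_fun L h j x = indicator {0..<L j} x * h (star_point j x)"

lemma sets_star_measure [simp, measurable_cong]: "sets (star_measure D L) = sets (star_borel D L)"
  by (simp add: star_measure_def)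

lemma space_star_measure [simp]: "space (star_measure D L) = star D L"
  by (simp add: star_measure_def)

lemma star_edges_sets: "star_edges D L \<in> sets (count_space UNIV \<Otimes>\<^sub>M lborel)"
proof -
  have "star_edges D L = (\<Union>j\<in>{1..D}. {j} \<times> {0..<L j})" by (auto simp: star_edges_def)
  then show ?thesis by auto
qed

lemma sigma_finite_count_nat: "pair_sigma_finite (count_space (UNIV :: nat set)) (lborel :: real measure)"
proof -
  interpret a: sigma_finite_measure "count_space (UNIV :: nat set)"
    by (rule sigma_finite_measure_count_space)
  show ?thesis by unfold_locales
qed

lemma emeasure_star_edges_finite: "emeasure (count_space UNIV \<Otimes>\<^sub>M lborel) (star_edges D L) < \<infinity>"
proof -
  interpret P: pair_sigma_finite "count_space (UNIV :: nat set)" "lborel :: real measure"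
    by (rule sigma_finite_count_nat)
  let ?B = "\<Sum>j\<in>{1..D}. \<bar>L j\<bar>"
  have le: "L j \<le> ?B" if "j \<in> {1..D}" for j
    using member_le_sum[of j "{1..D}" "\<lambda>j. \<bar>L j\<bar>"] that by fastforce
  have "emeasure (count_space UNIV \<Otimes>\<^sub>M lborel) (star_edges D L)
      \<le> emeasure (count_space UNIV \<Otimes>\<^sub>M lborel) ({1..D} \<times> {0..?B})"
    by (rule emeasure_mono) (use le in \<open>fastforce simp: star_edges_def\<close>)+
  also have "\<dots> = emeasure (count_space UNIV) {1..D} * emeasure lborel {0..?B}"
    by (rule lborel.emeasure_pair_measure_Times) auto
  also have "\<dots> < \<infinity>" by (simp add: emeasure_lborel_Icc_eq ennreal_mult_less_top of_nat_less_top)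
  finally show ?thesis .
qed

lemma finite_measure_star: "finite_measure (star_measure D L)"
proof
  let ?N = "count_space UNIV \<Otimes>\<^sub>M lborel :: (nat \<times> real) measure"
  let ?R = "restrict_space ?N (star_edges D L)"
  have "emeasure (star_measure D L) (space (star_measure D L))
      = emeasure ?R ((\<lambda>(j, x). star_point j x) -` star D L \<inter> space ?R)"
    unfolding star_measure_def using sets.top[of "star_borel D L"]
    by (subst emeasure_distr[OF measurable_star_point]) auto
  also have "\<dots> \<le> emeasure ?R (space ?R)" by (rule emeasure_mono) auto
  also have "\<dots> = emeasure ?N (star_edges D L)"
    using star_edges_sets by (subst emeasure_restrict_space) (auto simp: space_restrict_space space_pair_measure)
  finally show "emeasure (star_measure D L) (space (star_measure D L)) \<noteq> \<infinity>"
    using emeasure_star_edges_finite[of D L] by (auto simp: top.not_eq_extremum)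
qed

text \<open>
  The length measure of the star is the sum of the Lebesgue measures of the edges.
\<close>

lemma star_integral_edges:
  assumes h: "h \<in> borel_measurable (star_borel D L)" and K: "\<And>p. p \<in> star D L \<Longrightarrow> \<bar>h p\<bar> \<le> K"
  shows "\<And>j. j \<in> {1..D} \<Longrightarrow> edge_fun L h j \<in> borel_measurable borel"
    and "\<And>j x. j \<in> {1..D} \<Longrightarrow> \<bar>edge_fun L h j x\<bar> \<le> \<bar>K\<bar>"
    and "integrable (star_measure D L) h"
    and "(\<integral>p. h p \<partial>star_measure D L) = (\<Sum>j\<in>{1..D}. integral {0..L j} (edge_fun L h j))"
proof -
  interpret P: pair_sigma_finite "count_space (UNIV :: nat set)" "lborel :: real measure"
    by (rule sigma_finite_count_nat)
  let ?N = "count_space UNIV \<Otimes>\<^sub>M lborel :: (nat \<times> real) measure"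
  let ?E = "star_edges D L"
  define q where "q = (\<lambda>p. indicator ?E p *\<^sub>R h ((\<lambda>(j, x). star_point j x) p))"
  have E: "?E \<inter> space ?N \<in> sets ?N" using star_edges_sets by (simp add: space_pair_measure)
  have qm: "q \<in> borel_measurable ?N"
    unfolding q_def borel_measurable_restrict_space_iff[OF E, symmetric]
    by (rule measurable_compose[OF measurable_star_point h])
  have q_edge: "q (j, x) = (if j \<in> {1..D} then edge_fun L h j x else 0)" for j x
    by (auto simp: q_def edge_fun_def star_edges_def indicator_def)
  have q_bound: "\<bar>q p\<bar> \<le> \<bar>K\<bar> * indicator ?E p" for p
  proof (cases "p \<in> ?E")
    case True
    then have "(\<lambda>(j, x). star_point j x) p \<in> star D L" by (auto simp: star_def)
    from K[OF this] True show ?thesis by (simp add: q_def)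
  qed (simp add: q_def)
  show m: "edge_fun L h j \<in> borel_measurable borel" if "j \<in> {1..D}" for j
  proof -
    have "(\<lambda>x. q (j, x)) \<in> borel_measurable lborel"
      using measurable_compose[OF measurable_Pair1' qm, of j] by simp
    then show ?thesis using that by (simp add: q_edge)
  qed
  show b: "\<bar>edge_fun L h j x\<bar> \<le> \<bar>K\<bar>" if "j \<in> {1..D}" for j x
  proof -
    have "\<bar>q (j, x)\<bar> \<le> \<bar>K\<bar>"
      by (rule order_trans[OF q_bound]) (auto simp: indicator_def)
    then show ?thesis using that by (simp add: q_edge)
  qed
  have qi: "integrable ?N q"
  proof (rule integrableI_bounded_set[where A="?E" and B="\<bar>K\<bar>"])
    show "AE p in ?N. p \<in> ?E \<longrightarrow> norm (q p) \<le> \<bar>K\<bar>"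
    proof (intro AE_I2 impI)
      fix p assume "p \<in> ?E"
      then show "norm (q p) \<le> \<bar>K\<bar>" using q_bound[of p] by simp
    qed
    show "AE p in ?N. p \<notin> ?E \<longrightarrow> q p = 0" by (simp add: q_def)
  qed (use star_edges_sets emeasure_star_edges_finite qm in auto)
  then have ri: "integrable (restrict_space ?N ?E) (\<lambda>p. h ((\<lambda>(j, x). star_point j x) p))"
    unfolding integrable_restrict_space[OF E] q_def .
  then show "integrable (star_measure D L) h"
    unfolding star_measure_def by (subst integrable_distr_eq[OF measurable_star_point h])
  have "(\<integral>p. h p \<partial>star_measure D L) = (\<integral>p. q p \<partial>?N)"
    unfolding star_measure_def q_def
    by (subst integral_distr[OF measurable_star_point h], rule integral_restrict_space[OF E])
  also have "\<dots> = (\<integral>j. (\<integral>x. q (j, x) \<partial>lborel) \<partial>count_space UNIV)"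
    by (rule P.integral_fst'[OF qi, symmetric])
  also have "\<dots> = (\<integral>j. (if j \<in> {1..D} then integral {0..L j} (edge_fun L h j) else 0) \<partial>count_space UNIV)"
  proof (rule Bochner_Integration.integral_cong[OF refl])
    fix j
    show "(\<integral>x. q (j, x) \<partial>lborel) = (if j \<in> {1..D} then integral {0..L j} (edge_fun L h j) else 0)"
    proof (cases "j \<in> {1..D}")
      case True
      have eq: "indicat_real {0..L j} x * edge_fun L h j x = edge_fun L h j x" for x
        by (auto simp: edge_fun_def indicator_def)
      have "set_integrable lborel {0..L j} (edge_fun L h j)"
        unfolding set_integrable_def
        by (rule integrableI_bounded_set[where A="{0..L j}" and B="\<bar>K\<bar>"])
           (use m[OF True] b[OF True] in \<open>auto simp: emeasure_lborel_Icc_eq indicator_def\<close>)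
      from set_borel_integral_eq_integral(2)[OF this] show ?thesis
        using True by (simp add: q_edge set_lebesgue_integral_def eq)
    next
      case False
      then have "q (j, x) = 0" for x by (simp only: q_edge if_False)
      then show ?thesis using False by (simp only: if_False) simp
    qed
  qed
  also have "\<dots> = (\<Sum>j\<in>{1..D}. integral {0..L j} (edge_fun L h j))"
    by (subst lebesgue_integral_count_space_finite_support)
       (auto intro!: sum.mono_neutral_cong_left rev_finite_subset[of "{1..D}"] split: if_splits)
  finally show "(\<integral>p. h p \<partial>star_measure D L) = (\<Sum>j\<in>{1..D}. integral {0..L j} (edge_fun L h j))" .
qed

text \<open>
  Setting a Borel representative to zero on a null set, rather than changing values, keeps the pointwise
  sign structure of \<open>f\<close>: whatever separates the signs of \<open>f\<close> also separates those of \<open>g\<close>.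
\<close>

lemma star_borel_representative:
  fixes f :: "nat \<times> real \<Rightarrow> real"
  assumes f: "f \<in> borel_measurable (star_lebesgue D L)" and M: "AE p in star_lebesgue D L. \<bar>f p\<bar> \<le> M" "0 \<le> M"
  obtains g where "g \<in> borel_measurable (star_borel D L)" "\<And>p. g p = f p \<or> g p = 0" "\<And>p. \<bar>g p\<bar> \<le> M"
    "AE p in star_lebesgue D L. f p = g p"
proof -
  let ?m = "star_measure D L"
  obtain g0 where g0: "g0 \<in> borel_measurable ?m" "AE p in ?m. f p = g0 p"
    using completion_ex_borel_measurable_real[OF f[unfolded star_lebesgue_def]] by blast
  have "AE p in ?m. f p = g0 p \<and> \<bar>f p\<bar> \<le> M"
    using g0(2) M(1) unfolding star_lebesgue_def AE_completion_iff by eventually_elim simp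
  then obtain N where N: "N \<in> null_sets ?m" "{p \<in> space ?m. \<not> (f p = g0 p \<and> \<bar>f p\<bar> \<le> M)} \<subseteq> N"
    unfolding eventually_ae_filter by blast
  define g where "g p = indicator (space ?m - N) p * g0 p" for p
  have ok: "f p = g0 p" "\<bar>f p\<bar> \<le> M" if "p \<in> space ?m - N" for p using N(2) that by auto
  show ?thesis
  proof
    have "N \<in> sets ?m" using N(1) by auto
    then have "g \<in> borel_measurable ?m" unfolding g_def using g0(1) by measurable
    then show "g \<in> borel_measurable (star_borel D L)"
      by (simp cong: measurable_cong_sets)
    show "g p = f p \<or> g p = 0" for p using ok[of p] by (auto simp: g_def indicator_def)
    show "\<bar>g p\<bar> \<le> M" for p using ok[of p] M(2) by (auto simp: g_def indicator_def)
    have "AE p in ?m. p \<notin> N" using N(1) by (rule AE_not_in)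
    then have "AE p in ?m. f p = g p"
      using AE_space by eventually_elim (use ok in \<open>auto simp: g_def indicator_def\<close>)
    then show "AE p in star_lebesgue D L. f p = g p"
      unfolding star_lebesgue_def by (rule AE_completion)
  qed
qed

lemma star_lipschitz_measurable:
  assumes "\<And>p q. p \<in> star D L \<Longrightarrow> q \<in> star D L \<Longrightarrow> \<bar>\<phi> p - \<phi> q\<bar> \<le> star_dist p q"
  shows "\<phi> \<in> borel_measurable (star_borel D L)"
proof (rule borel_measurableI)
  interpret Metric_space "star D L" star_dist by (rule Metric_space_star)
  fix S :: "real set" assume S: "open S"
  have "continuous_map mtopology euclideanreal \<phi>"
    unfolding continuous_map_from_metric
  proof (intro conjI ballI allI impI)
    fix a U assume a: "a \<in> star D L" and U: "openin euclideanreal U \<and> \<phi> a \<in> U"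
    then obtain e where "e > 0" "ball (\<phi> a) e \<subseteq> U" by (auto simp: open_contains_ball)
    then show "\<exists>r>0. \<forall>x. x \<in> star D L \<and> star_dist a x < r \<longrightarrow> \<phi> x \<in> U"
      using assms[OF a] by (intro exI[of _ e]) (force simp: subset_iff dist_real_def)
  qed auto
  then have "openin (star_topology D L) {p \<in> star D L. \<phi> p \<in> S}"
    using openin_continuous_map_preimage[of mtopology euclideanreal \<phi> S] S
    by (simp add: star_topology_def)
  moreover have "\<phi> -` S \<inter> space (star_borel D L) = {p \<in> star D L. \<phi> p \<in> S}" by auto
  moreover have "{U. openin (star_topology D L) U} \<subseteq> Pow (star D L)"
    using openin_subset by fastforce
  ultimately show "\<phi> -` S \<inter> space (star_borel D L) \<in> sets (star_borel D L)"
    unfolding star_borel_def by (simp add: sigma_sets.Basic)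
qed

section \<open>Transport cost and flux\<close>

text \<open>
  The elementary half of Kantorovich duality.
\<close>

lemma wasserstein1_ge_potential:
  fixes \<phi> :: "'a \<Rightarrow> real"
  assumes fin: "finite_measure \<mu>" "finite_measure \<nu>" and sets: "sets \<nu> = sets \<mu>"
    and \<phi>: "\<phi> \<in> borel_measurable \<mu>" "\<And>p. p \<in> space \<mu> \<Longrightarrow> \<bar>\<phi> p\<bar> \<le> B"
    and lip: "\<And>p q. p \<in> space \<mu> \<Longrightarrow> q \<in> space \<mu> \<Longrightarrow> \<phi> p - \<phi> q \<le> d p q"
  shows "ennreal ((\<integral>p. \<phi> p \<partial>\<mu>) - (\<integral>p. \<phi> p \<partial>\<nu>)) \<le> wasserstein1 d \<mu> \<nu>"
  unfolding wasserstein1_def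
proof (rule INF_greatest)
  fix \<gamma> assume "\<gamma> \<in> {\<gamma>. coupling \<mu> \<nu> \<gamma>}"
  then have s\<gamma>: "sets \<gamma> = sets (\<mu> \<Otimes>\<^sub>M \<nu>)" and m: "distr \<gamma> \<mu> fst = \<mu>" "distr \<gamma> \<nu> snd = \<nu>"
    by (auto simp: coupling_def)
  have space: "space \<gamma> = space \<mu> \<times> space \<nu>" "space \<nu> = space \<mu>"
    using sets_eq_imp_space_eq[OF s\<gamma>] sets_eq_imp_space_eq[OF sets] by (auto simp: space_pair_measure)
  have fst: "fst \<in> \<gamma> \<rightarrow>\<^sub>M \<mu>" and snd: "snd \<in> \<gamma> \<rightarrow>\<^sub>M \<nu>"
    using measurable_cong_sets[OF s\<gamma> refl] by auto
  have \<phi>\<nu>: "\<phi> \<in> borel_measurable \<nu>" using \<phi>(1) measurable_cong_sets[OF sets refl] by auto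
  have int: "integrable \<mu> \<phi>" "integrable \<nu> \<phi>"
    using \<phi> \<phi>\<nu> space
    by (auto intro!: finite_measure.integrable_const_bound[OF fin(1), of _ B]
        finite_measure.integrable_const_bound[OF fin(2), of _ B])
  have i1: "integrable \<gamma> (\<lambda>z. \<phi> (fst z))" "(\<integral>z. \<phi> (fst z) \<partial>\<gamma>) = (\<integral>p. \<phi> p \<partial>\<mu>)"
    using int(1) integrable_distr_eq[OF fst \<phi>(1)] integral_distr[OF fst \<phi>(1)] by (simp_all add: m)
  have i2: "integrable \<gamma> (\<lambda>z. \<phi> (snd z))" "(\<integral>z. \<phi> (snd z) \<partial>\<gamma>) = (\<integral>p. \<phi> p \<partial>\<nu>)"
    using int(2) integrable_distr_eq[OF snd \<phi>\<nu>] integral_distr[OF snd \<phi>\<nu>] by (simp_all add: m)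
  let ?h = "\<lambda>z. \<phi> (fst z) - \<phi> (snd z)"
  have "(\<integral>p. \<phi> p \<partial>\<mu>) - (\<integral>p. \<phi> p \<partial>\<nu>) = (\<integral>z. ?h z \<partial>\<gamma>)"
    using i1 i2 by simp
  also have "\<dots> \<le> (\<integral>z. max 0 (?h z) \<partial>\<gamma>)"
    using i1 i2 by (intro integral_mono) auto
  finally have "ennreal ((\<integral>p. \<phi> p \<partial>\<mu>) - (\<integral>p. \<phi> p \<partial>\<nu>)) \<le> ennreal (\<integral>z. max 0 (?h z) \<partial>\<gamma>)"
    by (rule ennreal_leI)
  also have "\<dots> = (\<integral>\<^sup>+z. ennreal (max 0 (?h z)) \<partial>\<gamma>)"
    using i1 i2 by (intro nn_integral_eq_integral[symmetric]) auto
  also have "\<dots> \<le> (\<integral>\<^sup>+(p, q). ennreal (d p q) \<partial>\<gamma>)"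
  proof (rule nn_integral_mono)
    fix z assume "z \<in> space \<gamma>"
    then have "?h z \<le> d (fst z) (snd z)" using lip space by auto
    then show "ennreal (max 0 (?h z)) \<le> (case z of (p, q) \<Rightarrow> ennreal (d p q))"
      by (auto simp: max_def case_prod_beta ennreal_leI)
  qed
  finally show "ennreal ((\<integral>p. \<phi> p \<partial>\<mu>) - (\<integral>p. \<phi> p \<partial>\<nu>)) \<le> (\<integral>\<^sup>+(p, q). ennreal (d p q) \<partial>\<gamma>)" .
qed

lemma finite_measure_star_lebesgue: "finite_measure (star_lebesgue D L)"
proof
  show "emeasure (star_lebesgue D L) (space (star_lebesgue D L)) \<noteq> \<infinity>"
    using finite_measure.emeasure_finite[OF finite_measure_star[of D L], of "star D L"]
      sets.top[of "star_borel D L"]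
    by (simp add: star_lebesgue_def)
qed

lemma space_star_lebesgue [simp]: "space (star_lebesgue D L) = star D L"
  by (simp add: star_lebesgue_def)

lemma star_borel_measurable_lebesgue:
  "h \<in> borel_measurable (star_borel D L) \<Longrightarrow> h \<in> borel_measurable (star_lebesgue D L)"
  unfolding star_lebesgue_def by (rule measurable_completion) (simp cong: measurable_cong_sets)

lemma star_density_integral:
  assumes g: "g \<in> borel_measurable (star_lebesgue D L)" "\<And>p. 0 \<le> g p" "\<forall>p\<in>star D L. g p \<le> K"
  shows "finite_measure (star_density D L g)" "sets (star_density D L g) = sets (star_borel D L)"
    and "\<And>\<phi> :: nat \<times> real \<Rightarrow> real. \<phi> \<in> borel_measurable (star_borel D L) \<Longrightarrow>
      (\<integral>p. \<phi> p \<partial>star_density D L g) = (\<integral>p. g p * \<phi> p \<partial>star_lebesgue D L)"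
proof -
  let ?\<Lambda> = "star_lebesgue D L"
  let ?d = "density ?\<Lambda> (\<lambda>p. ennreal (g p))"
  interpret finite_measure ?\<Lambda> by (rule finite_measure_star_lebesgue)
  have id: "(\<lambda>p. p) \<in> ?d \<rightarrow>\<^sub>M star_borel D L"
  proof -
    have "(\<lambda>p. p) \<in> star_measure D L \<rightarrow>\<^sub>M star_borel D L"
      by (rule measurable_ident_sets) simp
    then have "(\<lambda>p. p) \<in> ?\<Lambda> \<rightarrow>\<^sub>M star_borel D L"
      unfolding star_lebesgue_def by (rule measurable_completion)
    then show ?thesis by simp
  qed
  show "sets (star_density D L g) = sets (star_borel D L)" by (simp add: star_density_def)
  show "finite_measure (star_density D L g)"
  proof
    have "emeasure (star_density D L g) (space (star_density D L g)) = emeasure ?d (space ?d)"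
      unfolding star_density_def using measurable_space[OF id] sets.top[of "star_borel D L"]
      by (subst emeasure_distr[OF id]) (auto intro!: arg_cong2[where f=emeasure])
    also have "\<dots> = (\<integral>\<^sup>+p. ennreal (g p) \<partial>?\<Lambda>)"
      using g(1) sets.top[of ?\<Lambda>] by (subst emeasure_density) (auto intro!: nn_integral_cong simp: indicator_def)
    also have "\<dots> \<le> (\<integral>\<^sup>+p. ennreal K \<partial>?\<Lambda>)"
      by (rule nn_integral_mono) (use g(3) in \<open>auto intro!: ennreal_leI\<close>)
    also have "\<dots> < \<infinity>"
    proof -
      have "emeasure ?\<Lambda> (star D L) < \<infinity>"
        using emeasure_finite[of "star D L"] unfolding infinity_ennreal_def top.not_eq_extremum .
      then show ?thesis by (simp add: ennreal_mult_less_top)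
    qed
    finally show "emeasure (star_density D L g) (space (star_density D L g)) \<noteq> \<infinity>" by simp
  qed
  fix \<phi> :: "nat \<times> real \<Rightarrow> real" assume \<phi>: "\<phi> \<in> borel_measurable (star_borel D L)"
  have "(\<integral>p. \<phi> p \<partial>star_density D L g) = (\<integral>p. \<phi> p \<partial>?d)"
    unfolding star_density_def by (rule integral_distr[OF id \<phi>])
  also have "\<dots> = (\<integral>p. g p *\<^sub>R \<phi> p \<partial>?\<Lambda>)"
    by (rule integral_density) (use \<phi> g star_borel_measurable_lebesgue in auto)
  finally show "(\<integral>p. \<phi> p \<partial>star_density D L g) = (\<integral>p. g p * \<phi> p \<partial>?\<Lambda>)" by simp
qed

lemma star_W1_ge_potential:
  assumes f: "f \<in> borel_measurable (star_lebesgue D L)" "bounded (f ` star D L)"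
    and lip: "\<And>p q. p \<in> star D L \<Longrightarrow> q \<in> star D L \<Longrightarrow> \<bar>\<phi> p - \<phi> q\<bar> \<le> star_dist p q"
    and B: "\<And>p. p \<in> star D L \<Longrightarrow> \<bar>\<phi> p\<bar> \<le> B"
  shows "ennreal (\<integral>p. \<phi> p * f p \<partial>star_lebesgue D L) \<le> star_W1 D L f"
proof -
  let ?\<Lambda> = "star_lebesgue D L"
  interpret finite_measure ?\<Lambda> by (rule finite_measure_star_lebesgue)
  obtain K where K: "\<And>p. p \<in> star D L \<Longrightarrow> \<bar>f p\<bar> \<le> K" using f(2) by (auto simp: bounded_iff)
  have \<phi>: "\<phi> \<in> borel_measurable (star_borel D L)" by (rule star_lipschitz_measurable[OF lip])
  have pos: "pos_part f \<in> borel_measurable ?\<Lambda>" "\<And>p. 0 \<le> pos_part f p"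
      "\<forall>p\<in>star D L. pos_part f p \<le> \<bar>K\<bar>"
    using f(1) K by (force simp: pos_part_def[abs_def])+
  have neg: "(\<lambda>p. \<bar>neg_part f p\<bar>) \<in> borel_measurable ?\<Lambda>" "\<And>p. 0 \<le> \<bar>neg_part f p\<bar>"
      "\<forall>p\<in>star D L. \<bar>neg_part f p\<bar> \<le> \<bar>K\<bar>"
    using f(1) K by (force simp: neg_part_def[abs_def])+
  note P = star_density_integral[OF pos] and N = star_density_integral[OF neg]
  have int: "integrable ?\<Lambda> (\<lambda>p. h p * \<phi> p)"
    if h: "h \<in> borel_measurable ?\<Lambda>" "\<And>p. p \<in> star D L \<Longrightarrow> \<bar>h p\<bar> \<le> \<bar>K\<bar>" for h
  proof (rule integrable_const_bound[of _ "\<bar>K\<bar> * \<bar>B\<bar>"])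
    show "AE p in ?\<Lambda>. norm (h p * \<phi> p) \<le> \<bar>K\<bar> * \<bar>B\<bar>"
    proof (rule AE_I2)
      fix p assume "p \<in> space ?\<Lambda>"
      then show "norm (h p * \<phi> p) \<le> \<bar>K\<bar> * \<bar>B\<bar>"
        using h(2)[of p] B[of p] by (auto simp: abs_mult intro!: mult_mono)
    qed
  qed (use h star_borel_measurable_lebesgue[OF \<phi>] in auto)
  have "(\<integral>p. \<phi> p * f p \<partial>?\<Lambda>) = (\<integral>p. pos_part f p * \<phi> p - \<bar>neg_part f p\<bar> * \<phi> p \<partial>?\<Lambda>)"
    by (rule Bochner_Integration.integral_cong[OF refl])
       (auto simp: pos_part_def neg_part_def max_def algebra_simps)
  also have "\<dots> = (\<integral>p. \<phi> p \<partial>star_density D L (pos_part f)) - (\<integral>p. \<phi> p \<partial>star_density D L (\<lambda>p. \<bar>neg_part f p\<bar>))"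
    unfolding P(3)[OF \<phi>] N(3)[OF \<phi>]
    by (rule Bochner_Integration.integral_diff; rule int) (use pos neg in auto)
  also have "ennreal \<dots> \<le> star_W1 D L f"
    unfolding star_W1_def
  proof (rule wasserstein1_ge_potential[OF P(1) N(1), where B=B])
    have sp: "space (star_density D L (pos_part f)) = star D L"
      using sets_eq_imp_space_eq[OF P(2)] by simp
    show "sets (star_density D L (\<lambda>p. \<bar>neg_part f p\<bar>)) = sets (star_density D L (pos_part f))"
      using P(2) N(2) by simp
    show "\<phi> \<in> borel_measurable (star_density D L (pos_part f))"
      using \<phi> measurable_cong_sets[OF P(2) refl] by auto
    show "\<And>p. p \<in> space (star_density D L (pos_part f)) \<Longrightarrow> \<bar>\<phi> p\<bar> \<le> B" using B sp by simp
    show "\<And>p q. p \<in> space (star_density D L (pos_part f)) \<Longrightarrow> q \<in> space (star_density D L (pos_part f))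
        \<Longrightarrow> \<phi> p - \<phi> q \<le> star_dist p q"
      using lip sp by (smt (verit))
  qed
  finally show ?thesis .
qed

text \<open>
  On a tree the Wasserstein distance is the integral of the absolute flux. The inequality proved here
  uses the potential that vanishes at the vertex and whose slope on each edge is the sign of the flux;
  being 1-Lipschitz on edges and zero at the vertex, it is 1-Lipschitz for the distance of the star.
\<close>

lemma star_W1_ge_flux:
  assumes f: "f \<in> borel_measurable (star_lebesgue D L)" "bounded (f ` star D L)"
    and L: "\<And>j. j \<in> {1..D} \<Longrightarrow> L j > 0"
    and g: "g \<in> borel_measurable (star_borel D L)" "\<And>p. \<bar>g p\<bar> \<le> M" "AE p in star_lebesgue D L. f p = g p"
  shows "ennreal (\<Sum>j\<in>{1..D}. integral {0..L j} (\<lambda>x. \<bar>flux (L j) (edge_fun L g j) x\<bar>)) \<le> star_W1 D L f"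
proof -
  note e = star_integral_edges(1,2)[where h=g, OF g(1,2)]
  define \<sigma> where "\<sigma> j x = sgn (flux (L j) (edge_fun L g j) x)" for j x
  define \<phi> where "\<phi> p = integral {0..snd p} (\<sigma> (fst p))" for p
  have m\<sigma>: "\<sigma> j \<in> borel_measurable borel" if "j \<in> {1..D}" for j
    unfolding \<sigma>_def using borel_measurable_flux[OF e[OF that]] by measurable
  have b\<sigma>: "\<bar>\<sigma> j x\<bar> \<le> 1" for j x by (auto simp: \<sigma>_def sgn_if)
  have inc: "\<bar>integral {0..x} (\<sigma> j) - integral {0..y} (\<sigma> j)\<bar> \<le> \<bar>x - y\<bar>"
    if j: "j \<in> {1..D}" and xy: "0 \<le> x" "0 \<le> y" for j x y
  proof -
    have *: "\<bar>integral {0..x} (\<sigma> j) - integral {0..y} (\<sigma> j)\<bar> \<le> \<bar>x - y\<bar>"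
      if "0 \<le> x" "x \<le> y" for x y
    proof -
      have ii: "\<sigma> j integrable_on {a..b}" for a b by (rule bounded_borel_integrable_on[OF m\<sigma>[OF j] b\<sigma>])
      have "integral {0..y} (\<sigma> j) = integral {0..x} (\<sigma> j) + integral {x..y} (\<sigma> j)"
        using Henstock_Kurzweil_Integration.integral_combine[OF that ii] by simp
      moreover have "\<bar>integral {x..y} (\<sigma> j)\<bar> \<le> 1 * (y - x)"
        by (rule integral_abs_le[OF ii b\<sigma> that(2)])
      ultimately show ?thesis using that by simp
    qed
    show ?thesis using *[of x y] *[of y x] xy by (cases "x \<le> y") (auto simp: abs_minus_commute)
  qed
  have \<phi>_pt: "\<phi> (star_point j x) = integral {0..x} (\<sigma> j)" for j x
    by (simp add: \<phi>_def star_point_def)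
  have elem: "\<exists>j x. j \<in> {1..D} \<and> 0 \<le> x \<and> x < L j \<and> p = star_point j x" if "p \<in> star D L" for p
    using that by (auto simp: star_def star_edges_def, blast)
  have lip: "\<bar>\<phi> p - \<phi> q\<bar> \<le> star_dist p q" if pq: "p \<in> star D L" "q \<in> star D L" for p q
  proof -
    obtain j x where p: "j \<in> {1..D}" "0 \<le> x" "p = star_point j x" using elem[OF pq(1)] by blast
    obtain k y where q: "k \<in> {1..D}" "0 \<le> y" "q = star_point k y" using elem[OF pq(2)] by blast
    show ?thesis
    proof (cases "j = k")
      case True
      then show ?thesis using inc[of j x y] p q by (simp add: \<phi>_pt star_dist_star_point)
    next
      case False
      then show ?thesis using inc[of j x 0] inc[of k y 0] p q by (simp add: \<phi>_pt star_dist_star_point)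
    qed
  qed
  have bound: "\<bar>\<phi> p\<bar> \<le> (\<Sum>j\<in>{1..D}. \<bar>L j\<bar>)" if p: "p \<in> star D L" for p
  proof -
    obtain j x where jx: "j \<in> {1..D}" "0 \<le> x" "x < L j" "p = star_point j x" using elem[OF p] by blast
    have "\<bar>\<phi> p\<bar> \<le> \<bar>L j\<bar>" using inc[of j x 0] jx by (simp add: \<phi>_pt)
    also have "\<dots> \<le> (\<Sum>j\<in>{1..D}. \<bar>L j\<bar>)" by (rule member_le_sum) (use jx in auto)
    finally show ?thesis .
  qed
  let ?B = "\<Sum>j\<in>{1..D}. \<bar>L j\<bar>"
  have \<phi>m: "\<phi> \<in> borel_measurable (star_borel D L)" by (rule star_lipschitz_measurable[OF lip])
  have "(\<integral>p. \<phi> p * f p \<partial>star_lebesgue D L) = (\<integral>p. \<phi> p * g p \<partial>star_lebesgue D L)"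
  proof (rule integral_cong_AE)
    show "AE p in star_lebesgue D L. \<phi> p * f p = \<phi> p * g p" using g(3) by eventually_elim simp
  qed (use f(1) star_borel_measurable_lebesgue[OF \<phi>m] star_borel_measurable_lebesgue[OF g(1)] in auto)
  also have "\<dots> = (\<integral>p. \<phi> p * g p \<partial>star_measure D L)"
    unfolding star_lebesgue_def by (rule integral_completion) (use \<phi>m g(1) in \<open>simp cong: measurable_cong_sets\<close>)
  also have "\<dots> = (\<Sum>j\<in>{1..D}. integral {0..L j} (edge_fun L (\<lambda>p. \<phi> p * g p) j))"
  proof (rule star_integral_edges(4)[where K="?B * M"])
    fix p assume "p \<in> star D L"
    then show "\<bar>\<phi> p * g p\<bar> \<le> ?B * M"
      unfolding abs_mult by (intro mult_mono bound g(2)) (auto intro: sum_nonneg)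
  qed (use \<phi>m g(1) in auto)
  also have "\<dots> = (\<Sum>j\<in>{1..D}. integral {0..L j} (\<lambda>x. \<bar>flux (L j) (edge_fun L g j) x\<bar>))"
  proof (rule sum.cong[OF refl])
    fix j assume j: "j \<in> {1..D}"
    have "edge_fun L (\<lambda>p. \<phi> p * g p) j = (\<lambda>x. integral {0..x} (\<sigma> j) * edge_fun L g j x)"
      by (auto simp: edge_fun_def \<phi>_pt)
    then show "integral {0..L j} (edge_fun L (\<lambda>p. \<phi> p * g p) j)
        = integral {0..L j} (\<lambda>x. \<bar>flux (L j) (edge_fun L g j) x\<bar>)"
      using integral_abs_flux_dual[OF e[OF j], of "L j"] L[OF j] by (simp add: \<sigma>_def[abs_def])
  qed
  finally show ?thesis using star_W1_ge_potential[OF f lip bound] by simp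
qed

section \<open>Counting the sign changes\<close>

definition edge_trace :: "(nat \<Rightarrow> real) \<Rightarrow> (nat \<times> real) set \<Rightarrow> nat \<Rightarrow> real set"
  where "edge_trace L W j = {x \<in> {0<..<L j}. star_point j x \<in> W}"

lemma card_edge_traces:
  assumes "finite W"
  shows "finite (edge_trace L W j)"
    and "(\<Sum>j\<in>{1..D}. card (edge_trace L W j)) \<le> card (W - {(0, 0)})"
proof -
  have img: "Pair j ` edge_trace L W j \<subseteq> W" for j by (auto simp: edge_trace_def star_point_def)
  show fin: "finite (edge_trace L W j)" for j
    using finite_subset[OF img assms, of j] by (rule finite_imageD) (simp add: inj_on_def)
  have "(\<Sum>j\<in>{1..D}. card (edge_trace L W j)) = card (SIGMA j:{1..D}. edge_trace L W j)"
    using fin by simp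
  also have "\<dots> \<le> card (W - {(0, 0)})"
    by (rule card_mono) (use assms in \<open>auto simp: edge_trace_def star_point_def\<close>)
  finally show "(\<Sum>j\<in>{1..D}. card (edge_trace L W j)) \<le> card (W - {(0, 0)})" .
qed

lemma separates_signs_crossing:
  assumes W: "separates_signs D L W f" and gf: "\<And>p. g p = f p \<or> g p = 0"
    and kl: "k \<in> {1..D}" "l \<in> {1..D}" "k \<noteq> l" and ab: "- L l < a" "a \<le> b" "b < L k"
    and neg: "g (star_line k l a) * g (star_line k l b) < 0"
  shows "\<exists>s\<in>{a..b}. star_line k l s \<in> W"
proof -
  have "f (star_line k l a) * f (star_line k l b) < 0"
    using neg gf[of "star_line k l a"] gf[of "star_line k l b"] by auto
  then show ?thesis using W kl ab unfolding separates_signs_def by blast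
qed

lemma edge_fun_in: "x \<in> {0..<L j} \<Longrightarrow> edge_fun L g j x = g (star_point j x)"
  by (simp add: edge_fun_def)

text \<open>
  A segment of one edge is a part of the line through that edge and any second edge.
\<close>

lemma edge_trace_between:
  assumes W: "separates_signs D L W f" and gf: "\<And>p. g p = f p \<or> g p = 0"
    and D: "D \<ge> 2" and L: "\<And>j. j \<in> {1..D} \<Longrightarrow> L j > 0" and j: "j \<in> {1..D}"
    and xy: "x \<in> {0<..<L j}" "y \<in> {0<..<L j}" and neg: "edge_fun L g j x * edge_fun L g j y < 0"
  shows "{min x y..max x y} \<inter> edge_trace L W j \<noteq> {}"
proof -
  define l where "l = (if j = 1 then 2 else 1 :: nat)"
  have l: "l \<in> {1..D}" "j \<noteq> l" using D by (auto simp: l_def)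
  have "\<exists>s\<in>{min x y..max x y}. star_line j l s \<in> W"
  proof (rule separates_signs_crossing[OF W gf j l])
    show "g (star_line j l (min x y)) * g (star_line j l (max x y)) < 0"
      using neg xy by (auto simp: min_def max_def star_line_nonneg edge_fun_in mult.commute)
  qed (use xy L[OF l(1)] in auto)
  then obtain s where "s \<in> {min x y..max x y}" "star_line j l s \<in> W" by blast
  then show ?thesis using xy by (auto simp: edge_trace_def star_line_nonneg min_def max_def split: if_splits)
qed

lemma sign_changes_in_edge_trace:
  assumes "separates_signs D L W f" "\<And>p. g p = f p \<or> g p = 0"
    and "D \<ge> 2" "\<And>j. j \<in> {1..D} \<Longrightarrow> L j > 0" and j: "j \<in> {1..D}"
  shows "sign_changes_in (edge_trace L W j) (L j) (edge_fun L g j)"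
  unfolding sign_changes_in_def
proof (intro allI impI)
  fix a b assume ab: "0 \<le> a" "b \<le> L j" and no: "{a<..<b} \<inter> edge_trace L W j = {}"
  have "\<not> edge_fun L g j x * edge_fun L g j y < 0" if xy: "x \<in> {a<..<b}" "y \<in> {a<..<b}" for x y
  proof
    assume "edge_fun L g j x * edge_fun L g j y < 0"
    then have "{min x y..max x y} \<inter> edge_trace L W j \<noteq> {}"
      using xy ab by (intro edge_trace_between[OF assms]) auto
    moreover have "{min x y..max x y} \<subseteq> {a<..<b}" using xy by auto
    ultimately show False using no by blast
  qed
  then show "(\<forall>x\<in>{a<..<b}. edge_fun L g j x \<ge> 0) \<or> (\<forall>x\<in>{a<..<b}. edge_fun L g j x \<le> 0)"
    by (meson linorder_not_le mult_neg_pos)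
qed

text \<open>
  If the vertex does not separate the signs, two points that see the vertex without meeting \<open>W\<close> also
  see each other.
\<close>

lemma one_signed_near_vertex:
  assumes W: "separates_signs D L W f" and gf: "\<And>p. g p = f p \<or> g p = 0"
    and D: "D \<ge> 2" and L: "\<And>j. j \<in> {1..D} \<Longrightarrow> L j > 0" and 0: "(0, 0) \<notin> W"
  defines "near \<equiv> \<lambda>j x. j \<in> {1..D} \<and> x \<in> {0<..<L j} \<and> {0<..x} \<inter> edge_trace L W j = {}"
  shows "(\<forall>j x. near j x \<longrightarrow> edge_fun L g j x \<ge> 0) \<or> (\<forall>j x. near j x \<longrightarrow> edge_fun L g j x \<le> 0)"
proof -
  have "\<not> edge_fun L g j x * edge_fun L g i y < 0" if nx: "near j x" and ny: "near i y" for i j x y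
  proof
    assume neg: "edge_fun L g j x * edge_fun L g i y < 0"
    show False
    proof (cases "i = j")
      case True
      then have "{min x y..max x y} \<inter> edge_trace L W j \<noteq> {}"
        using nx ny neg by (intro edge_trace_between[OF W gf D L]) (auto simp: near_def)
      moreover have "{min x y..max x y} \<subseteq> {0<..x} \<union> {0<..y}"
        using nx ny by (auto simp: near_def)
      ultimately show False using nx ny True unfolding near_def by blast
    next
      case False
      have "\<exists>s\<in>{- y..x}. star_line j i s \<in> W"
      proof (rule separates_signs_crossing[OF W gf])
        show "g (star_line j i (- y)) * g (star_line j i x) < 0"
          using neg nx ny star_line_swap[of i j y]
          by (auto simp: near_def star_line_nonneg edge_fun_in star_line_swap mult.commute)
      qed (use nx ny False in \<open>auto simp: near_def\<close>)
      then obtain s where s: "s \<in> {- y..x}" "star_line j i s \<in> W" by blast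
      consider "s = 0" | "0 < s" | "s < 0" by linarith
      then show False
      proof cases
        case 1
        then show False using s 0 by simp
      next
        case 2
        then have "s \<in> {0<..x} \<inter> edge_trace L W j"
          using s nx by (auto simp: near_def edge_trace_def star_line_nonneg)
        then show False using nx unfolding near_def by blast
      next
        case 3
        have "y < L i" using ny by (simp add: near_def)
        then have "- s \<in> {0<..y} \<inter> edge_trace L W i"
          using s 3 by (simp add: edge_trace_def star_line_def)
        then show False using ny unfolding near_def by blast
      qed
    qed
  qed
  then show ?thesis by (meson linorder_not_le mult_neg_pos)
qed

text \<open>
  The bookkeeping of the count: if the vertex belongs to the separating set, at most \<open>|Z| - 1\<close> of its
  points are interior to edges and the vertex pays \<open>vertex_weight D\<close>. If it does not, up to \<open>|Z|\<close> points
  are interior to edges, and the bound for a one-signed neighbourhood of the vertex gains the missing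
  \<open>r\<^sup>2\<close>.
\<close>

lemma star_flux_excess_lower:
  assumes Z: "effective_nodal_set (star_topology D L) f Z" "finite Z"
    and gf: "\<And>p. g p = f p \<or> g p = 0"
    and D: "D \<ge> 2" and L: "\<And>j. j \<in> {1..D} \<Longrightarrow> L j > 0"
    and g: "\<And>j. j \<in> {1..D} \<Longrightarrow> edge_fun L g j \<in> borel_measurable borel"
      "\<And>j x. j \<in> {1..D} \<Longrightarrow> \<bar>edge_fun L g j x\<bar> \<le> K"
    and g0: "(\<Sum>j\<in>{1..D}. flux (L j) (edge_fun L g j) 0) = 0" and r: "r > 0"
  shows "- (real (card Z) - 1 + vertex_weight D) * r\<^sup>2
    \<le> (\<Sum>j\<in>{1..D}. flux_excess r (L j) (edge_fun L g j) 0)"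
proof -
  obtain W where W: "finite W" "card W \<le> card Z" "separates_signs D L W f"
    by (rule separating_set_exists[OF Z])
  let ?W = "edge_trace L W" and ?g = "edge_fun L g"
  let ?n = "\<Sum>j\<in>{1..D}. real (card (?W j))"
  note fin = card_edge_traces(1)[OF W(1)]
  have n: "?n \<le> real (card (W - {(0, 0)}))"
    using card_edge_traces(2)[OF W(1), of L D] by (simp flip: of_nat_sum)
  have sub: "?W j \<subseteq> {0<..<L j}" for j by (auto simp: edge_trace_def)
  note ch = sign_changes_in_edge_trace[OF W(3) gf D L]
  have ch': "sign_changes_in (?W j) (L j) (\<lambda>x. - ?g j x)" if "j \<in> {1..D}" for j
    using ch[OF _ that] unfolding sign_changes_in_def by (simp add: disj_commute)
  have low: "- (real (card Z) - 1 + vertex_weight D) * r\<^sup>2 \<le> - c * r\<^sup>2"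
    if "c \<le> real (card Z) - 1 + vertex_weight D" for c
    using that by (intro mult_right_mono) auto
  show ?thesis
  proof (cases "(0, 0) \<in> W")
    case True
    then have "card (W - {(0, 0)}) = card W - 1" "card W \<ge> 1"
      using W(1) by (auto simp: card_gt_0_iff Suc_le_eq)
    then have "vertex_weight D + ?n \<le> real (card Z) - 1 + vertex_weight D" using n W(2) by linarith
    from low[OF this] show ?thesis
      by (rule order_trans) (rule sum_flux_excess_lower(1)[OF _ _ D r g L fin sub ch g0], simp_all)
  next
    case False
    then have "vertex_weight D - 1 + ?n \<le> real (card Z) - 1 + vertex_weight D" using n W(2) by simp
    note le = low[OF this]
    consider "\<And>j x. j \<in> {1..D} \<Longrightarrow> x \<in> {0<..<L j} \<Longrightarrow> {0<..x} \<inter> ?W j = {} \<Longrightarrow> ?g j x \<ge> 0"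
      | "\<And>j x. j \<in> {1..D} \<Longrightarrow> x \<in> {0<..<L j} \<Longrightarrow> {0<..x} \<inter> ?W j = {} \<Longrightarrow> ?g j x \<le> 0"
      using one_signed_near_vertex[OF W(3) gf D L False] by blast
    then show ?thesis
    proof cases
      case 1
      show ?thesis
        by (rule order_trans[OF le])
           (rule sum_flux_excess_lower(2)[OF _ _ D r g L fin sub ch g0 1], simp_all)
    next
      case 2
      have "- (vertex_weight D - 1 + ?n) * r\<^sup>2 \<le> (\<Sum>j\<in>{1..D}. flux_excess r (L j) (\<lambda>x. - ?g j x) 0)"
        by (rule sum_flux_excess_lower(2)[where K=K, OF _ _ D r _ _ L fin sub ch'])
           (use g g0 2 in \<open>auto simp: sum_negf\<close>)
      then show ?thesis using le by simp
    qed
  qed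
qed

theorem mainTheorem5:
  fixes D :: nat and L :: "nat \<Rightarrow> real" and f :: "nat \<times> real \<Rightarrow> real" and Z :: "(nat \<times> real) set"
  assumes "D \<ge> 2"
    and "\<And>j. j \<in> {1..D} \<Longrightarrow> L j > 0"
    and "bounded (f ` star D L)"
    and "f \<in> borel_measurable (star_lebesgue D L)"
    and "\<not> (AE p in star_lebesgue D L. f p = 0)"
    and "(\<integral>p. f p \<partial>star_lebesgue D L) = 0"
    and "effective_nodal_set (star_topology D L) f Z"
    and "finite Z" and "Z \<noteq> {}"
    and "\<And>j. j \<in> {1..D} \<Longrightarrow> L j > star_L1_norm D L f / star_Linf_norm D L f"
  shows "star_W1 D L f *
      ennreal (real (card Z) - 1 +
        (if even D then real D / 2 else (real D + 1) * (real D - 1) / (2 * real D)))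
    \<ge> ennreal (1 / 4 * (star_L1_norm D L f / star_Linf_norm D L f) * star_L1_norm D L f)"
proof -
  note D = assms(1) and L = assms(2)
  let ?\<Lambda> = "star_lebesgue D L"
  define A where "A = star_L1_norm D L f"
  define M where "M = star_Linf_norm D L f"
  define N where "N = real (card Z) - 1 + vertex_weight D"
  interpret finite_measure ?\<Lambda> by (rule finite_measure_star_lebesgue)
  obtain K where K: "\<And>p. p \<in> star D L \<Longrightarrow> \<bar>f p\<bar> \<le> K" using assms(3) by (auto simp: bounded_iff)
  let ?F = "\<lambda>p. ereal \<bar>f p\<bar>"
  have Fm: "?F \<in> borel_measurable ?\<Lambda>" using assms(4) by measurable
  have up: "esssup ?\<Lambda> ?F \<le> ereal K" by (rule esssup_I[OF Fm]) (use K in auto)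
  have AE_le: "AE p in ?\<Lambda>. ?F p \<le> esssup ?\<Lambda> ?F" by (rule esssup_AE)
  have lo: "0 < esssup ?\<Lambda> ?F"
  proof (rule ccontr)
    assume "\<not> 0 < esssup ?\<Lambda> ?F"
    then have "AE p in ?\<Lambda>. f p = 0" using AE_le
    proof (elim AE_mp, intro AE_I2 impI)
      fix p assume "\<not> 0 < esssup ?\<Lambda> ?F" "?F p \<le> esssup ?\<Lambda> ?F"
      then have "?F p \<le> 0" using order_trans not_less by metis
      then show "f p = 0" by simp
    qed
    then show False using assms(5) by blast
  qed
  have M_eq: "esssup ?\<Lambda> ?F = ereal M"
    unfolding M_def star_Linf_norm_def using up lo by (cases "esssup ?\<Lambda> ?F") auto
  have M: "0 < M" using lo by (simp add: M_eq)
  have fM: "AE p in ?\<Lambda>. \<bar>f p\<bar> \<le> M" using AE_le by (simp add: M_eq)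
  obtain g where g: "g \<in> borel_measurable (star_borel D L)" "\<And>p. g p = f p \<or> g p = 0"
      "\<And>p. \<bar>g p\<bar> \<le> M" "AE p in ?\<Lambda>. f p = g p"
    using star_borel_representative[OF assms(4) fM] M by auto
  have gm: "g \<in> borel_measurable (star_measure D L)" using g(1) by (simp cong: measurable_cong_sets)
  have gl: "g \<in> borel_measurable ?\<Lambda>" by (rule star_borel_measurable_lebesgue[OF g(1)])
  let ?g = "edge_fun L g"
  have e: "\<And>j. j \<in> {1..D} \<Longrightarrow> ?g j \<in> borel_measurable borel"
      "\<And>j x. j \<in> {1..D} \<Longrightarrow> \<bar>?g j x\<bar> \<le> M"
    using star_integral_edges(1,2)[where h=g, OF g(1,3)] M by auto
  have g0: "(\<Sum>j\<in>{1..D}. flux (L j) (?g j) 0) = 0"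
  proof -
    have "0 = (\<integral>p. g p \<partial>?\<Lambda>)"
      unfolding assms(6)[symmetric] by (rule integral_cong_AE[OF assms(4) gl g(4)])
    also have "\<dots> = (\<integral>p. g p \<partial>star_measure D L)"
      unfolding star_lebesgue_def by (rule integral_completion[OF gm])
    also have "\<dots> = (\<Sum>j\<in>{1..D}. integral {0..L j} (?g j))"
      by (rule star_integral_edges(4)[OF g(1,3)])
    finally show ?thesis by (simp add: flux_def)
  qed
  have A_eq: "A = (\<Sum>j\<in>{1..D}. integral {0..L j} (\<lambda>x. \<bar>?g j x\<bar>))"
  proof -
    have "A = (\<integral>p. \<bar>g p\<bar> \<partial>?\<Lambda>)"
      unfolding A_def star_L1_norm_def
    proof (rule integral_cong_AE)
      show "AE p in ?\<Lambda>. \<bar>f p\<bar> = \<bar>g p\<bar>" using g(4) by eventually_elim simp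
    qed (use assms(4) gl in auto)
    also have "\<dots> = (\<integral>p. \<bar>g p\<bar> \<partial>star_measure D L)"
      unfolding star_lebesgue_def by (rule integral_completion) (use gm in auto)
    also have "\<dots> = (\<Sum>j\<in>{1..D}. integral {0..L j} (edge_fun L (\<lambda>p. \<bar>g p\<bar>) j))"
      by (rule star_integral_edges(4)[where K=M]) (use g(1,3) in auto)
    also have "\<dots> = (\<Sum>j\<in>{1..D}. integral {0..L j} (\<lambda>x. \<bar>?g j x\<bar>))"
    proof -
      have "edge_fun L (\<lambda>p. \<bar>g p\<bar>) j = (\<lambda>x. \<bar>?g j x\<bar>)" for j
        by (auto simp: edge_fun_def abs_mult)
      then show ?thesis by simp
    qed
    finally show ?thesis .
  qed
  define w where "w = (\<Sum>j\<in>{1..D}. integral {0..L j} (\<lambda>x. \<bar>flux (L j) (?g j) x\<bar>))"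
  have w0: "0 \<le> w" unfolding w_def
    by (intro sum_nonneg integral_nonneg)
       (auto intro!: integrable_continuous_interval continuous_on_rabs continuous_flux[OF e])
  have W1: "ennreal w \<le> star_W1 D L f"
    unfolding w_def by (rule star_W1_ge_flux[OF assms(4,3) L g(1,3,4)])
  have A0: "0 < A"
  proof -
    have "integrable ?\<Lambda> (\<lambda>p. \<bar>f p\<bar>)"
      by (rule integrable_const_bound[of _ K]) (use K assms(4) in auto)
    from integral_nonneg_eq_0_iff_AE[OF this] have "A \<noteq> 0"
      using assms(5) by (auto simp: A_def star_L1_norm_def)
    moreover have "0 \<le> A" by (simp add: A_def star_L1_norm_def)
    ultimately show ?thesis by simp
  qed
  have N0: "0 < N"
  proof -
    have "card Z \<ge> 1" using assms(8,9) by (simp add: card_gt_0_iff Suc_le_eq)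
    then show ?thesis using vertex_weight_ge_1[OF D] by (simp add: N_def)
  qed
  \<comment> \<open>The maximiser of \<open>r * A - N * r\<^sup>2\<close>.\<close>
  define r where "r = A / (2 * N)"
  have r: "0 < r" using A0 N0 by (simp add: r_def)
  have "- N * r\<^sup>2 \<le> (\<Sum>j\<in>{1..D}. flux_excess r (L j) (?g j) 0)"
    unfolding N_def by (rule star_flux_excess_lower[OF assms(7,8) g(2) D L e g0 r])
  also have "\<dots> \<le> (\<Sum>j\<in>{1..D}. M * integral {0..L j} (\<lambda>x. \<bar>flux (L j) (?g j) x\<bar>)
      - r * integral {0..L j} (\<lambda>x. \<bar>?g j x\<bar>))"
  proof (rule sum_mono)
    fix j assume j: "j \<in> {1..D}"
    have i1: "(\<lambda>x. \<bar>flux (L j) (?g j) x\<bar>) integrable_on {0..L j}"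
      by (intro integrable_continuous_interval continuous_on_rabs continuous_flux[OF e[OF j]])
    have i2: "(\<lambda>x. \<bar>?g j x\<bar>) integrable_on {0..L j}"
      by (rule bounded_borel_integrable_on[where K=M]) (use e[OF j] in auto)
    \<comment> \<open>Here \<open>\<bar>g\<bar> \<le> M\<close> enters.\<close>
    have "flux_excess r (L j) (?g j) 0
        \<le> integral {0..L j} (\<lambda>x. M * \<bar>flux (L j) (?g j) x\<bar> - r * \<bar>?g j x\<bar>)"
      unfolding flux_excess_def
    proof (rule integral_le)
      show "(\<lambda>x. (\<bar>flux (L j) (?g j) x\<bar> - r) * \<bar>?g j x\<bar>) integrable_on {0..L j}"
        by (rule integrable_comp_flux_times[OF e[OF j], where G'="\<lambda>v. \<bar>v\<bar> - r" and K'=M])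
           (use e[OF j] in \<open>auto intro!: continuous_intros\<close>)
      show "(\<lambda>x. M * \<bar>flux (L j) (?g j) x\<bar> - r * \<bar>?g j x\<bar>) integrable_on {0..L j}"
        by (intro Henstock_Kurzweil_Integration.integrable_diff integrable_on_mult_right i1 i2)
      fix x
      have "\<bar>flux (L j) (?g j) x\<bar> * \<bar>?g j x\<bar> \<le> \<bar>flux (L j) (?g j) x\<bar> * M"
        by (rule mult_left_mono[OF e(2)[OF j]]) simp
      then show "(\<bar>flux (L j) (?g j) x\<bar> - r) * \<bar>?g j x\<bar> \<le> M * \<bar>flux (L j) (?g j) x\<bar> - r * \<bar>?g j x\<bar>"
        by (simp add: algebra_simps)
    qed
    also have "\<dots> = M * integral {0..L j} (\<lambda>x. \<bar>flux (L j) (?g j) x\<bar>) - r * integral {0..L j} (\<lambda>x. \<bar>?g j x\<bar>)"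
      by (subst Henstock_Kurzweil_Integration.integral_diff) (auto intro!: integrable_on_mult_right i1 i2)
    finally show "flux_excess r (L j) (?g j) 0 \<le> M * integral {0..L j} (\<lambda>x. \<bar>flux (L j) (?g j) x\<bar>)
      - r * integral {0..L j} (\<lambda>x. \<bar>?g j x\<bar>)" .
  qed
  also have "\<dots> = M * w - r * A"
    by (simp add: sum_subtractf sum_distrib_left w_def A_eq)
  finally have "r * A - N * r\<^sup>2 \<le> M * w" by simp
  moreover have "r * A - N * r\<^sup>2 = A\<^sup>2 / (4 * N)"
    using N0 by (simp add: r_def power2_eq_square field_simps)
  ultimately have "A\<^sup>2 / (4 * N) * (N / M) \<le> M * w * (N / M)"
    using M N0 by (intro mult_right_mono) auto
  then have "1 / 4 * (A / M) * A \<le> w * N"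
    using M N0 by (simp add: power2_eq_square mult.commute)
  then have "ennreal (1 / 4 * (A / M) * A) \<le> ennreal w * ennreal N"
    using w0 N0 by (simp add: ennreal_mult[symmetric] ennreal_leI)
  also have "\<dots> \<le> star_W1 D L f * ennreal N" by (rule mult_right_mono[OF W1]) simp
  finally show ?thesis by (simp add: A_def M_def N_def vertex_weight_def)
qed

end
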